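(* Let $k,m,n\in\mathbb{N}$ with $k\geq2$ and $m+1\geq n\geq1$ and $m\geq 1$, and $0<\vartheta<\varepsilon\leq1$. Then there exists a positive integer $\mathrm{Cor}_n(k,m,\vartheta,\varepsilon)$ with the following property. If $W$ is a Carlson--Simpson tree of $[k]^{<\mathbb{N}}$ of dimension at least $\mathrm{Cor}_n(k,m,\vartheta,\varepsilon)$, then for every family $\{A_w:w\in W\}$ of measurable events in a probability space $(\Omega,\Sigma,\mu)$ satisfying $\mu(A_w)\geq\varepsilon$ for every $w\in W$ there exists a Carlson--Simpson subtree $U$ of $W$ with $\dim(U)=m$ and such that for every $F\in\mathrm{Fr}_n(U)$ we have \[ \mu\Big(\bigcap_{w\in F}A_w\Big)\geq\vartheta^n. \]
   Context: $\mathbb{N}=\{0,1,2,\dots\}$ and $[k]=\{1,\dots,k\}$. A word over $k$ is a finite (possibly empty) sequence with values in $[k]$; $[k]^{<\mathbb{N}}$ is the set of all words over $k$; $|w|$ is the length of $w$; concatenation is denoted $u\circ v$. Fix a letter $x\notin[k]$ (a variable). A left variable word over $k$ is a finite nonempty sequence with values in $[k]\cup\{x\}$ whose first letter is $x$; $w(a)$ is obtained by replacing every occurrence of $x$ in $w$ by $a\in[k]$. A Carlson--Simpson tree of $[k]^{<\mathbb{N}}$ of dimension $m\geq1$ is a set of the form \[ \{w\}\cup\big\{w\circ w_0(a_0)\circ\cdots\circ w_n(a_n): n\in\{0,\dots,m-1\},\ a_0,\dots,a_n\in[k]\big\} \] where $w$ is a word over $k$ and $w_0,\dots,w_{m-1}$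 are left variable words over $k$ (uniquely determined by the tree). A Carlson--Simpson subtree of $W$ is a Carlson--Simpson tree of $[k]^{<\mathbb{N}}$ contained in $W$; $\dim$ denotes dimension. For a nonempty set $G$ of words, $\wedge G$ is the longest word which is an initial segment of every element of $G$. Free sets: $\mathrm{Fr}_1([k]^{<\mathbb{N}})$ and $\mathrm{Fr}_2([k]^{<\mathbb{N}})$ are the families of all singletons and of all two-element subsets of $[k]^{<\mathbb{N}}$, respectively; for $n\geq2$, $\mathrm{Fr}_{n+1}([k]^{<\mathbb{N}})$ consists of all sets of the form $\{w\}\cup G$ with $w\in[k]^{<\mathbb{N}}$, $G\in\mathrm{Fr}_n([k]^{<\mathbb{N}})$ and $|w|<|\wedge G|$. For a Carlson--Simpson tree $U$, $\mathrm{Fr}_n(U)$ is the set of all $F\in\mathrm{Fr}_n([k]^{<\mathbb{N}})$ with $F\subseteq U$ (every such $F$ has exactly $n$ elements). *)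

theory Defs
  imports "HOL-Probability.Probability" "HOL-Library.Sublist"
begin

text \<open>
  Words over \<open>k\<close> are the elements of \<open>lists {1..k}\<close>. In variable words the letter
  \<open>None\<close> is the variable \<open>x\<close> and \<open>Some a\<close> is the letter \<open>a\<close>.
\<close>

definition left_variable_words :: "nat \<Rightarrow> nat option list set" where
  "left_variable_words k =
     {v. v \<noteq> [] \<and> hd v = None \<and> set v \<subseteq> insert None (Some ` {1..k})}"

definition subst_var :: "nat option list \<Rightarrow> nat \<Rightarrow> nat list" where
  "subst_var v a = map (\<lambda>l. case l of None \<Rightarrow> a | Some b \<Rightarrow> b) v"

definition cs_span :: "nat \<Rightarrow> nat list \<Rightarrow> nat option list list \<Rightarrow> nat list set" where
  "cs_span k w ws =
     {w} \<union> {w @ concat (map2 subst_var (take (Suc n) ws) as) | n as.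
              n < length ws \<and> length as = Suc n \<and> set as \<subseteq> {1..k}}"

text \<open>\<open>cs_tree k m W\<close>: \<open>W\<close> is a Carlson--Simpson tree of dimension \<open>m\<close>.\<close>

definition cs_tree :: "nat \<Rightarrow> nat \<Rightarrow> nat list set \<Rightarrow> bool" where
  "cs_tree k m W \<longleftrightarrow>
     1 \<le> m \<and>
     (\<exists>w\<in>lists {1..k}. \<exists>ws. length ws = m \<and> set ws \<subseteq> left_variable_words k \<and> W = cs_span k w ws)"

text \<open>The value at \<open>0\<close> is a dummy: free sets have at least one element.\<close>

fun Fr :: "nat \<Rightarrow> nat \<Rightarrow> nat list set set" where
  "Fr k 0 = {}"
| "Fr k (Suc 0) = {{w} | w. w \<in> lists {1..k}}"
| "Fr k (Suc (Suc 0)) = {F. F \<subseteq> lists {1..k} \<and> card F = 2}"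
| "Fr k (Suc (Suc (Suc n))) =
     {insert w G | w G. w \<in> lists {1..k} \<and> G \<in> Fr k (Suc (Suc n)) \<and>
                        length w < length (Longest_common_prefix G)}"

text \<open>
  The constant must be independent of the probability space, hence also of the type of its
  points, but types cannot be quantified below an existential quantifier. It is therefore
  fixed through probability spaces on \<open>nat list set\<close>, the type of the random set
  \<open>{w \<in> W. \<omega> \<in> A w}\<close>. That a number with this property exists, and that it works for
  probability spaces on every type, is a claim to be proved; without it the value of
  \<open>Cor n k m \<theta> \<epsilon>\<close> would be unspecified.
\<close>

definition Cor :: "nat \<Rightarrow> nat \<Rightarrow> nat \<Rightarrow> real \<Rightarrow> real \<Rightarrow> nat" where
  "Cor n k m \<theta> \<epsilon> =
     (LEAST N. 0 < N \<and>
        (\<forall>d W. N \<le> d \<longrightarrow> cs_tree k d W \<longrightarrow>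
          (\<forall>(M :: nat list set measure) A. prob_space M \<longrightarrow>
             (\<forall>w\<in>W. A w \<in> sets M \<and> \<epsilon> \<le> measure M (A w)) \<longrightarrow>
             (\<exists>U\<subseteq>W. cs_tree k m U \<and>
                (\<forall>F\<in>Fr k n. F \<subseteq> U \<longrightarrow> \<theta> ^ n \<le> measure M (\<Inter>w\<in>F. A w))))))"

end

theory Submission
  imports Defs
begin

text \<open>
  Suppose that no dimension suffices. A limit of counterexamples along an ultrafilter is a law on all words,
  that is, a consistent family of probabilities that a random set of words contains a given finite set. Let \<open>l\<close>
  be an idempotent ultrafilter on left variable words that absorbs its own substitution instances. The limit of
  the law along the Carlson--Simpson trees generated by an \<open>l\<close>-generic sequence of left variable words is a
  law \<open>\<nu>\<close> invariant under all Carlson--Simpson embeddings, so it suffices to show \<open>\<epsilon>\<^sup>n \<le> \<nu> F\<close> for free \<open>F\<close>.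

  If all elements of \<open>Q\<close> are shorter than \<open>w\<close>, then \<open>\<nu> (Q \<union> w G)\<close> does not depend on \<open>w\<close>: this follows from
  the orthogonality of martingale differences along the random branches of a binary tree. Hence \<open>\<nu> F\<close> depends only
  on the size of \<open>F\<close> when the elements of \<open>F\<close> have distinct lengths, and Cauchy--Schwarz gives the bound. If the
  last two elements of \<open>F\<close> have the same length, the second moment of a difference of two averages shows that
  \<open>\<nu> F\<close> is at least the value for distinct lengths.
\<close>

section \<open>Idempotent ultrafilters on words\<close>

text \<open>The idempotent ultrafilter does the work of a Ramsey theorem. Along a generic subtree
  invariance under embeddings holds exactly in the limit, so no approximation errors accumulate; in
  exchange, the argument by contradiction gives no explicit dimension. No probability space is built
  for the limit law: only finite marginals occur, and they range over compact simplices.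

  The gap between \<theta> and \<epsilon> pays for the return from the limit. There the bound is
  \<open>\<epsilon> ^ n\<close>, which strictly exceeds \<open>\<theta> ^ n\<close>; a strict
  inequality between limits holds eventually, and only finitely many sets \<open>F\<close> occur in
  dimension \<open>m\<close>.

  Words of equal length are the obstacle. Embeddings preserve equality of lengths, so a pair on one
  level cannot be moved onto a chain, and only an inequality can be expected. It comes from placing
  the pair in a long sequence of words on one level, any two of which form a pair of the same
  type.\<close>

text \<open>On ultrafilters this is the product of the Stone-Cech compactification of the free
  monoid. A filter stands for the closed set of ultrafilters below it, and \<open>\<le>\<close> for
  inclusion. The left factor is quantified first, so \<open>F \<odot> p\<close> with an ultrafilter
  \<open>p\<close> is a right translate of the closed set \<open>F\<close>.\<close>

definition filter_append :: "'a list filter \<Rightarrow> 'a list filter \<Rightarrow> 'a list filter" (infixr "\<odot>" 70)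
  where "F \<odot> G = Abs_filter (\<lambda>P. \<forall>\<^sub>F s in F. \<forall>\<^sub>F t in G. P (s @ t))"

lemma eventually_filter_append:
  "eventually P (F \<odot> G) \<longleftrightarrow> (\<forall>\<^sub>F s in F. \<forall>\<^sub>F t in G. P (s @ t))"
  unfolding filter_append_def
proof (rule eventually_Abs_filter, rule is_filter.intro)
  show "\<forall>\<^sub>F s in F. \<forall>\<^sub>F t in G. True" by simp
next
  fix P Q assume "\<forall>\<^sub>F s in F. \<forall>\<^sub>F t in G. P (s @ t)" "\<forall>\<^sub>F s in F. \<forall>\<^sub>F t in G. Q (s @ t)"
  then show "\<forall>\<^sub>F s in F. \<forall>\<^sub>F t in G. P (s @ t) \<and> Q (s @ t)"
    by (simp add: eventually_conj_iff)
next
  fix P Q :: "'a list \<Rightarrow> bool" assume "\<forall>x. P x \<longrightarrow> Q x" "\<forall>\<^sub>F s in F. \<forall>\<^sub>F t in G. P (s @ t)"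
  then show "\<forall>\<^sub>F s in F. \<forall>\<^sub>F t in G. Q (s @ t)"
    by (auto elim!: eventually_mono)
qed

lemma filter_append_assoc: "(F \<odot> G) \<odot> H = F \<odot> (G \<odot> H)"
  by (simp add: filter_eq_iff eventually_filter_append)

lemma filter_append_mono: "F \<le> F' \<Longrightarrow> G \<le> G' \<Longrightarrow> F \<odot> G \<le> F' \<odot> G'"
  unfolding le_filter_def eventually_filter_append by (blast intro: eventually_mono)

lemma filter_append_Nil [simp]: "F \<odot> principal {[]} = F" "principal {[]} \<odot> F = F"
  by (simp_all add: filter_eq_iff eventually_filter_append eventually_principal)

lemma filtermap_filter_append:
  assumes "\<And>s t. f (s @ t) = f s @ f t"
  shows "filtermap f (F \<odot> G) = filtermap f F \<odot> filtermap f G"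
  by (simp add: filter_eq_iff eventually_filter_append eventually_filtermap assms)

definition ultrafilter :: "'a filter \<Rightarrow> bool"
  where "ultrafilter F \<longleftrightarrow> F \<noteq> bot \<and> (\<forall>P. eventually P F \<or> (\<forall>\<^sub>F x in F. \<not> P x))"

lemma ultrafilter_not_bot: "ultrafilter F \<Longrightarrow> F \<noteq> bot"
  by (simp add: ultrafilter_def)

lemma ultrafilter_not_eventually:
  assumes "ultrafilter F"
  shows "\<not> eventually P F \<longleftrightarrow> (\<forall>\<^sub>F x in F. \<not> P x)"
proof
  assume "\<forall>\<^sub>F x in F. \<not> P x"
  show "\<not> eventually P F"
  proof
    assume "eventually P F"
    with \<open>\<forall>\<^sub>F x in F. \<not> P x\<close> have "\<forall>\<^sub>F x in F. False" by eventually_elim simp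
    then show False using assms by (simp add: ultrafilter_def trivial_limit_def)
  qed
qed (use assms in \<open>auto simp: ultrafilter_def\<close>)

lemma ultrafilter_le_eq:
  assumes "ultrafilter F" "G \<le> F" "G \<noteq> bot"
  shows "G = F"
proof (rule antisym[OF assms(2)])
  show "F \<le> G"
  proof (rule filter_leI)
    fix P assume P: "eventually P G"
    show "eventually P F"
    proof (rule ccontr)
      assume "\<not> eventually P F"
      then have "\<forall>\<^sub>F x in G. \<not> P x"
        using assms ultrafilter_not_eventually filter_leD by blast
      with P have "\<forall>\<^sub>F x in G. False" by eventually_elim simp
      with assms(3) show False by (simp add: trivial_limit_def)
    qed
  qed
qed

lemma ultrafilter_filter_append:
  assumes "ultrafilter F" "ultrafilter G"
  shows "ultrafilter (F \<odot> G)"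
  unfolding ultrafilter_def
proof (intro conjI allI)
  show "F \<odot> G \<noteq> bot"
    using assms by (simp add: trivial_limit_def eventually_filter_append ultrafilter_def)
  show "eventually P (F \<odot> G) \<or> (\<forall>\<^sub>F x in F \<odot> G. \<not> P x)" for P
    unfolding eventually_filter_append
    using assms by (simp flip: ultrafilter_not_eventually)
qed

lemma ultrafilter_filtermap:
  assumes "ultrafilter F"
  shows "ultrafilter (filtermap f F)"
  using assms by (auto simp: ultrafilter_def filtermap_bot_iff eventually_filtermap)

lemma ultrafilter_principal_singleton: "ultrafilter (principal {x})"
  by (auto simp: ultrafilter_def eventually_principal principal_eq_bot_iff)

lemma eventually_Inf_chain:
  assumes "C \<noteq> {}" "\<And>F G. F \<in> C \<Longrightarrow> G \<in> C \<Longrightarrow> F \<le> G \<or> G \<le> F"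
  shows "eventually P (Inf C) \<longleftrightarrow> (\<exists>F\<in>C. eventually P F)"
proof -
  have "eventually P (INF F\<in>C. F) \<longleftrightarrow> (\<exists>F\<in>C. eventually P F)"
  proof (rule eventually_INF_base)
    fix F G assume "F \<in> C" "G \<in> C"
    then show "\<exists>H\<in>C. H \<le> inf F G" using assms(2)[of F G] by auto
  qed (fact assms(1))
  then show ?thesis by simp
qed

text \<open>Zorn's lemma for descending chains. Properness survives because \<open>False\<close>
  could hold eventually in \<open>Inf C\<close> only if it did so in a member of \<open>C\<close>:
  compactness in the language of filters.\<close>

lemma minimal_filter_exists:
  fixes F0 :: "'a filter"
  assumes "F0 \<noteq> bot" "\<Phi> F0"
    and chain: "\<And>C. C \<noteq> {} \<Longrightarrow> (\<And>F G. F \<in> C \<Longrightarrow> G \<in> C \<Longrightarrow> F \<le> G \<or> G \<le> F) \<Longrightarrow>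
                  (\<And>F. F \<in> C \<Longrightarrow> \<Phi> F) \<Longrightarrow> \<Phi> (Inf C)"
  obtains F where "F \<le> F0" "F \<noteq> bot" "\<Phi> F" "\<And>G. G \<le> F \<Longrightarrow> G \<noteq> bot \<Longrightarrow> \<Phi> G \<Longrightarrow> G = F"
proof -
  define A where "A = {F. F \<le> F0 \<and> F \<noteq> bot \<and> \<Phi> F}"
  have "\<exists>m\<in>A. \<forall>a\<in>A. m \<ge> a \<longrightarrow> a = m"
  proof (rule predicate_Zorn)
    show "partial_order_on A (relation_of (\<ge>) A)"
      by (rule partial_order_on_relation_ofI) (auto intro: order.trans antisym)
  next
    fix C assume "C \<in> Chains (relation_of (\<ge>) A)"
    then have C: "C \<subseteq> A" and lin: "\<And>F G. F \<in> C \<Longrightarrow> G \<in> C \<Longrightarrow> F \<le> G \<or> G \<le> F"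
      unfolding Chains_def relation_of_def by auto
    show "\<exists>u\<in>A. \<forall>a\<in>C. a \<ge> u"
    proof (cases "C = {}")
      case True
      then show ?thesis using assms by (auto simp: A_def)
    next
      case False
      have "Inf C \<noteq> bot"
        using C eventually_Inf_chain[OF False lin, of "\<lambda>_. False"] unfolding trivial_limit_def A_def
        by auto
      moreover have "\<Phi> (Inf C)" using C chain[OF False lin] by (auto simp: A_def)
      moreover have "Inf C \<le> F0" using C False unfolding A_def by (blast intro: Inf_lower2)
      ultimately have "Inf C \<in> A" by (simp add: A_def)
      then show ?thesis by (blast intro: Inf_lower)
    qed
  qed
  then obtain F where "F \<in> A" "\<And>G. G \<in> A \<Longrightarrow> G \<le> F \<Longrightarrow> G = F" by blast
  then show thesis by (intro that[of F]) (auto simp: A_def)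
qed

lemma ultrafilter_exists:
  fixes F0 :: "'a filter"
  assumes "F0 \<noteq> bot"
  obtains F where "F \<le> F0" "ultrafilter F"
proof -
  obtain F where F: "F \<le> F0" "F \<noteq> bot" "\<And>G. G \<le> F \<Longrightarrow> G \<noteq> bot \<Longrightarrow> G = F"
    using minimal_filter_exists[OF assms, of "\<lambda>_. True"] by auto
  have "eventually P F \<or> (\<forall>\<^sub>F x in F. \<not> P x)" for P
  proof (cases "inf F (principal {x. P x}) = bot")
    case True
    then have "eventually (\<lambda>x. x \<in> {x. P x} \<longrightarrow> False) F"
      by (simp add: trivial_limit_def eventually_inf_principal)
    then show ?thesis by simp
  next
    case False
    then have "inf F (principal {x. P x}) = F" by (intro F(3)) auto
    then have "F \<le> principal {x. P x}" by (metis inf.cobounded2)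
    then show ?thesis by (simp add: le_principal)
  qed
  with F that show thesis by (auto simp: ultrafilter_def)
qed

text \<open>The parameter \<open>H\<close> covers two uses: \<open>H F = F\<close> for closed
  subsemigroups, and a constant \<open>H\<close> for left ideals.\<close>

lemma filter_append_le_Inf:
  assumes "C \<noteq> {}" "\<And>F G. F \<in> C \<Longrightarrow> G \<in> C \<Longrightarrow> F \<le> G \<or> G \<le> F"
    and "\<And>F. F \<in> C \<Longrightarrow> H F \<odot> F \<le> F" "\<And>F. F \<in> C \<Longrightarrow> K \<le> H F"
  shows "K \<odot> Inf C \<le> Inf C"
proof (rule Inf_greatest)
  fix F assume F: "F \<in> C"
  have "K \<odot> Inf C \<le> H F \<odot> F" using F assms by (intro filter_append_mono Inf_lower) auto
  then show "K \<odot> Inf C \<le> F" using F assms by force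
qed

text \<open>The Ellis--Numakura lemma; proper filters play the role of the nonempty closed sets of ultrafilters.\<close>

lemma idempotent_ultrafilter_exists:
  assumes "F0 \<noteq> bot" "F0 \<odot> F0 \<le> F0"
  obtains p where "p \<le> F0" "ultrafilter p" "p \<odot> p = p"
proof -
  obtain F where F: "F \<le> F0" "F \<noteq> bot" "F \<odot> F \<le> F"
    and min: "\<And>G. G \<le> F \<Longrightarrow> G \<noteq> bot \<Longrightarrow> G \<odot> G \<le> G \<Longrightarrow> G = F"
  proof (rule minimal_filter_exists[where \<Phi> = "\<lambda>F. F \<odot> F \<le> F", OF assms])
    fix C :: "'a list filter set"
    assume C: "C \<noteq> {}" "\<And>F G. F \<in> C \<Longrightarrow> G \<in> C \<Longrightarrow> F \<le> G \<or> G \<le> F" "\<And>F. F \<in> C \<Longrightarrow> F \<odot> F \<le> F"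
    show "Inf C \<odot> Inf C \<le> Inf C"
      by (rule filter_append_le_Inf[where H = "\<lambda>F. F"]) (use C in \<open>auto intro: Inf_lower\<close>)
  qed blast
  obtain p where p: "p \<le> F" "ultrafilter p" using ultrafilter_exists[OF F(2)] .
  \<comment> \<open>As a closed set, \<open>F \<odot> p\<close> is a subsemigroup inside the minimal
    \<open>F\<close>.\<close>
  have Fp: "F \<odot> p = F"
  proof (rule min)
    show "F \<odot> p \<le> F" using filter_append_mono[OF order_refl p(1)] F(3) by (rule order_trans)
    show "F \<odot> p \<noteq> bot" using F(2) p(2)
      by (simp add: trivial_limit_def eventually_filter_append ultrafilter_def)
    have "p \<odot> F \<odot> p \<le> F \<odot> p"
      using filter_append_mono[OF order_trans[OF filter_append_mono[OF p(1) order_refl] F(3)] order_refl]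
      by (simp add: filter_append_assoc)
    then show "(F \<odot> p) \<odot> (F \<odot> p) \<le> F \<odot> p"
      unfolding filter_append_assoc
      using filter_append_mono[OF order_refl, of "p \<odot> F \<odot> p" "F \<odot> p" F]
        filter_append_mono[OF F(3) order_refl, of p]
      by (simp add: filter_append_assoc)
  qed
  \<comment> \<open>\<open>G\<close> collects the elements \<open>q\<close> of \<open>F\<close> with
    \<open>q \<odot> p = p\<close>. It is proper because \<open>p\<close> lies below
    \<open>F = F \<odot> p\<close>, and it is closed under products; minimality turns all of
    \<open>F\<close> into solutions, which gives \<open>F \<odot> p \<le> p\<close>.\<close>
  define Q where "Q P = {s. \<forall>\<^sub>F t in p. P (s @ t)}" for P
  define G where "G = inf F (INF P\<in>{P. eventually P p}. principal (Q P))"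
  have ne: "{P. eventually P p} \<noteq> {}" using eventually_True by blast
  have evG: "eventually R G \<longleftrightarrow> (\<exists>P. eventually P p \<and> (\<forall>\<^sub>F s in F. s \<in> Q P \<longrightarrow> R s))" for R
  proof -
    have "G = (INF P\<in>{P. eventually P p}. inf F (principal (Q P)))"
      unfolding G_def by (subst INF_inf_distrib[symmetric]) (simp only: INF_constant ne if_False)
    moreover have "eventually R (INF P\<in>{P. eventually P p}. inf F (principal (Q P)))
       \<longleftrightarrow> (\<exists>P\<in>{P. eventually P p}. eventually R (inf F (principal (Q P))))"
    proof (rule eventually_INF_base)
      show "{P. eventually P p} \<noteq> {}" by (fact ne)
      fix P P' assume "P \<in> {P. eventually P p}" "P' \<in> {P. eventually P p}"
      then have "(\<lambda>x. P x \<and> P' x) \<in> {P. eventually P p}" by (simp add: eventually_conj)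
      moreover have "Q (\<lambda>x. P x \<and> P' x) = Q P \<inter> Q P'" by (auto simp: Q_def eventually_conj_iff)
      ultimately show "\<exists>x\<in>{P. eventually P p}. inf F (principal (Q x)) \<le>
          inf (inf F (principal (Q P))) (inf F (principal (Q P')))"
        by (intro bexI[of _ "\<lambda>x. P x \<and> P' x"]) (auto intro: le_infI2)
    qed
    ultimately show ?thesis by (simp add: eventually_inf_principal)
  qed
  have "G = F"
  proof (rule min)
    show "G \<le> F" by (simp add: G_def)
    show "G \<noteq> bot"
    proof
      assume "G = bot"
      then obtain P where P: "eventually P p" "\<forall>\<^sub>F s in F. s \<notin> Q P"
        using evG[of "\<lambda>_. False"] by auto
      then have "\<forall>\<^sub>F x in F \<odot> p. \<not> P x"
        using p(2) by (simp add: eventually_filter_append Q_def ultrafilter_not_eventually)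
      then have "\<forall>\<^sub>F x in p. \<not> P x" using Fp p(1) filter_leD by metis
      with P(1) p(2) show False using ultrafilter_not_eventually by blast
    qed
    show "G \<odot> G \<le> G"
    proof (rule filter_leI)
      fix R assume "eventually R G"
      then obtain P where P: "eventually P p" "\<forall>\<^sub>F s in F. s \<in> Q P \<longrightarrow> R s" using evG by blast
      have "\<forall>\<^sub>F u in G \<odot> G. u \<in> Q P \<longrightarrow> R u"
        using P(2) F(3) \<open>G \<le> F\<close> by (meson filter_append_mono filter_leD)
      moreover have "\<forall>\<^sub>F s in G. s \<in> Q P" using P(1) evG by auto
      then have "\<forall>\<^sub>F u in G \<odot> G. u \<in> Q P"
        unfolding eventually_filter_append
      proof eventually_elim
        case (elim s)
        then have "\<forall>\<^sub>F t in p. P (s @ t)" by (simp add: Q_def)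
        then have "\<forall>\<^sub>F u in G. u \<in> Q (\<lambda>t. P (s @ t))" using evG by auto
        then show ?case by (simp add: Q_def)
      qed
      ultimately show "eventually R (G \<odot> G)" by eventually_elim blast
    qed
  qed
  then have GF: "eventually R F" if "eventually P p" "\<And>s. s \<in> Q P \<Longrightarrow> R s" for P R
    using that evG[of R] by (auto intro: always_eventually)
  have "F \<odot> p \<le> p"
    by (rule filter_leI) (auto simp: eventually_filter_append intro: GF simp: Q_def)
  then have "F = p" using p F(2) Fp ultrafilter_le_eq by metis
  then show thesis using that F p Fp by metis
qed

text \<open>Morally \<open>q = r \<odot> p\<close> for some \<open>r\<close>, whence
  \<open>q \<odot> p = r \<odot> p \<odot> p = q\<close>. The proof avoids extracting
  \<open>r\<close>: a predicate separating \<open>q\<close> from \<open>q \<odot> p\<close> yields a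
  single word \<open>s\<close> at which the idempotence of \<open>p\<close> fails.\<close>

lemma filter_append_right_identity:
  assumes "ultrafilter q" "q \<le> principal A \<odot> p" "ultrafilter p" "p \<odot> p = p"
  shows "q \<odot> p = q"
proof (rule ultrafilter_le_eq[OF assms(1)])
  show "q \<odot> p \<noteq> bot" using assms ultrafilter_filter_append ultrafilter_not_bot by blast
  show "q \<odot> p \<le> q"
  proof (rule filter_leI, rule ccontr)
    fix P assume P: "eventually P q" and nP: "\<not> eventually P (q \<odot> p)"
    have pp: "eventually R p \<longleftrightarrow> (\<forall>\<^sub>F t in p. \<forall>\<^sub>F u in p. R (t @ u))" for R
      using eventually_filter_append[of R p p] assms(4) by simp
    have "\<forall>\<^sub>F u in q. P u \<and> (\<forall>\<^sub>F t in p. \<not> P (u @ t))"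
      using P nP assms by (simp add: eventually_filter_append ultrafilter_not_eventually eventually_conj_iff)
    then have "\<not> (\<forall>\<^sub>F u in principal A \<odot> p. \<not> (P u \<and> (\<forall>\<^sub>F t in p. \<not> P (u @ t))))"
      using assms(1,2) ultrafilter_not_eventually filter_leD by blast
    then obtain s where "\<forall>\<^sub>F t in p. P (s @ t) \<and> (\<forall>\<^sub>F u in p. \<not> P (s @ t @ u))"
      using assms(3)
      by (auto simp: eventually_filter_append eventually_principal ultrafilter_not_eventually simp del: de_Morgan_conj)
    then have "\<forall>\<^sub>F t in p. P (s @ t)" "\<forall>\<^sub>F t in p. \<not> P (s @ t)"
      using pp[of "\<lambda>t. \<not> P (s @ t)"] by (auto elim: eventually_mono simp: eventually_conj_iff)
    then show False using assms(3) ultrafilter_not_eventually by blast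
  qed
qed

section \<open>Substitution and an absorbing ultrafilter on left variable words\<close>

text \<open>The letter \<open>e\<close> may be the variable itself, and then nothing changes;
  idempotence and absorption of constant instances thus become one equation.\<close>

definition subst_letter :: "nat option \<Rightarrow> nat option list \<Rightarrow> nat option list"
  where "subst_letter e v = map (\<lambda>l. case l of None \<Rightarrow> e | Some b \<Rightarrow> Some b) v"

lemma subst_letter_append: "subst_letter e (s @ t) = subst_letter e s @ subst_letter e t"
  by (simp add: subst_letter_def)

lemma subst_letter_None [simp]: "subst_letter None = (\<lambda>v. v)"
proof -
  have "(\<lambda>l. case l of None \<Rightarrow> None | Some b \<Rightarrow> Some b) = (\<lambda>l::nat option. l)"
    by (auto split: option.splits)
  then show ?thesis by (simp add: subst_letter_def fun_eq_iff)
qed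

definition letters :: "nat \<Rightarrow> nat option set"
  where "letters k = insert None (Some ` {1..k})"

text \<open>Given a minimal left ideal of ultrafilters on constant words and an idempotent \<open>p\<close> in it, take \<open>l\<close>
  idempotent in the left ideal generated by \<open>p\<close>. Each \<open>subst_letter (Some a) l\<close> is an idempotent of the
  minimal left ideal, hence a right identity of it.\<close>

lemma left_variable_ultrafilter:
  obtains l where "ultrafilter l" "l \<le> principal (left_variable_words k)"
    "\<And>e. e \<in> letters k \<Longrightarrow> l \<odot> filtermap (subst_letter e) l = l"
proof -
  define B where "B = principal (lists (Some ` {1..k}))"
  define A where "A = principal (lists (letters k))"
  have BB: "B \<odot> B \<le> B"
    by (auto simp: B_def le_principal eventually_filter_append eventually_principal)
  have AA: "A \<odot> A \<le> A"
    by (auto simp: A_def le_principal eventually_filter_append eventually_principal)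
  obtain F where F: "F \<le> B" "F \<noteq> bot" "B \<odot> F \<le> F"
    and min: "\<And>G. G \<le> F \<Longrightarrow> G \<noteq> bot \<Longrightarrow> B \<odot> G \<le> G \<Longrightarrow> G = F"
  proof (rule minimal_filter_exists[of B "\<lambda>F. B \<odot> F \<le> F"])
    show "B \<noteq> bot" by (auto simp: B_def principal_eq_bot_iff)
    show "B \<odot> B \<le> B" by (fact BB)
    fix C :: "nat option list filter set"
    assume C: "C \<noteq> {}" "\<And>F G. F \<in> C \<Longrightarrow> G \<in> C \<Longrightarrow> F \<le> G \<or> G \<le> F" "\<And>F. F \<in> C \<Longrightarrow> B \<odot> F \<le> F"
    show "B \<odot> Inf C \<le> Inf C"
      by (rule filter_append_le_Inf[where H = "\<lambda>_. B"]) (use C in auto)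
  qed blast
  have "F \<odot> F \<le> F" using filter_append_mono[OF F(1) order_refl] F(3) by (rule order_trans)
  then obtain p where p: "p \<le> F" "ultrafilter p" "p \<odot> p = p"
    using idempotent_ultrafilter_exists F(2) by blast
  \<comment> \<open>An idempotent \<open>e\<close> in the minimal left ideal \<open>F\<close>
    generates it, so \<open>p \<le> B \<odot> e\<close> and \<open>e\<close> is a right identity for
    \<open>p\<close>.\<close>
  have p_right: "p \<odot> e = p" if e: "e \<le> F" "ultrafilter e" "e \<odot> e = e" for e
  proof -
    have "B \<odot> e = F"
    proof (rule min)
      show "B \<odot> e \<le> F" using filter_append_mono[OF order_refl e(1)] F(3) by (rule order_trans)
      show "B \<odot> e \<noteq> bot"
        using e(2) unfolding trivial_limit_def
        by (auto simp: eventually_filter_append ultrafilter_def B_def eventually_principal)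
      show "B \<odot> B \<odot> e \<le> B \<odot> e"
        using filter_append_mono[OF BB order_refl, of e] by (simp add: filter_append_assoc)
    qed
    then show ?thesis using p(1,2) e(2,3) filter_append_right_identity B_def by blast
  qed
  \<comment> \<open>Left variable words are stable under appending, \<open>A \<odot> p\<close> under
    prepending, so \<open>V\<close> is closed under products. A variable followed by a
    \<open>p\<close>-generic constant word shows that \<open>V\<close> is proper.\<close>
  define V where "V = inf (principal (left_variable_words k)) (A \<odot> p)"
  have "principal {[None]} \<odot> p \<le> V"
    unfolding V_def
  proof (rule le_infI)
    have "eventually (\<lambda>s. s \<in> lists (Some ` {1..k})) p"
      using p(1) F(1) filter_leD[of p B] by (auto simp: B_def eventually_principal)
    then show "principal {[None]} \<odot> p \<le> principal (left_variable_words k)"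
      by (auto simp: le_principal eventually_filter_append eventually_principal left_variable_words_def
          elim!: eventually_mono)
    show "principal {[None]} \<odot> p \<le> A \<odot> p"
      by (rule filter_append_mono) (auto simp: A_def letters_def)
  qed
  moreover have "principal {[None]} \<odot> p \<noteq> bot"
    using p(2) by (simp add: ultrafilter_filter_append ultrafilter_not_bot ultrafilter_principal_singleton)
  ultimately have "V \<noteq> bot" by (metis bot.extremum_uniqueI)
  have pA: "p \<le> A" using p(1) F(1) by (auto simp: A_def B_def letters_def intro: order_trans)
  have VA: "V \<le> A" using AA filter_append_mono[OF order_refl pA, of A] by (auto simp: V_def intro: le_infI2)
  have "V \<odot> V \<le> V"
  proof -
    have "V \<odot> V \<le> principal (left_variable_words k) \<odot> A"
      by (rule filter_append_mono) (use VA in \<open>auto simp: V_def\<close>)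
    also have "\<dots> \<le> principal (left_variable_words k)"
      by (auto simp: le_principal eventually_filter_append eventually_principal left_variable_words_def
          A_def letters_def)
    finally have 1: "V \<odot> V \<le> principal (left_variable_words k)" .
    have "V \<odot> V \<le> A \<odot> A \<odot> p"
      by (rule filter_append_mono) (use VA in \<open>auto simp: V_def\<close>)
    also have "\<dots> \<le> A \<odot> p" using filter_append_mono[OF AA order_refl, of p] by (simp add: filter_append_assoc)
    finally show ?thesis using 1 by (subst (3) V_def) simp
  qed
  then obtain l where l: "l \<le> V" "ultrafilter l" "l \<odot> l = l"
    using idempotent_ultrafilter_exists \<open>V \<noteq> bot\<close> by blast
  have lp: "l \<odot> p = l"
    using l(1,2) p(2,3) by (intro filter_append_right_identity[of l "lists (letters k)"]) (auto simp: V_def A_def)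
  have "l \<odot> filtermap (subst_letter e) l = l" if e: "e \<in> letters k" for e
  proof (cases e)
    case None
    then show ?thesis using l(3) by (simp add: filtermap_ident)
  next
    case (Some a)
    then have a: "a \<in> {1..k}" using e by (auto simp: letters_def)
    let ?T = "filtermap (subst_letter e)"
    have "eventually (\<lambda>s. s \<in> lists (Some ` {1..k})) p"
      using p(1) F(1) filter_leD[of p B] by (auto simp: B_def eventually_principal)
    then have "eventually (\<lambda>s. subst_letter e s = s) p"
    proof eventually_elim
      case (elim s)
      then show ?case unfolding subst_letter_def by (intro map_idI) auto
    qed
    then have Tp: "?T p = p"
      unfolding filter_eq_iff eventually_filtermap by (auto elim: eventually_elim2)
    have "(case x of None \<Rightarrow> e | Some b \<Rightarrow> Some b) \<in> Some ` {1..k}" if "x \<in> letters k" for x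
      using that a Some by (auto simp: letters_def)
    then have "subst_letter e ` lists (letters k) \<subseteq> lists (Some ` {1..k})"
      unfolding subst_letter_def by (intro image_subsetI) auto
    then have "?T A \<le> B" by (simp add: A_def B_def filtermap_principal)
    then have "?T (A \<odot> p) \<le> B \<odot> p"
      by (simp add: filtermap_filter_append[OF subst_letter_append] Tp filter_append_mono)
    also have "\<dots> \<le> F" using filter_append_mono[OF order_refl p(1)] F(3) by (rule order_trans)
    finally have "?T (A \<odot> p) \<le> F" .
    moreover have "l \<le> A \<odot> p" using l(1) by (simp add: V_def)
    ultimately have "?T l \<le> F" by (meson filtermap_mono order_trans)
    moreover have "?T l \<odot> ?T l = ?T l"
      by (simp add: l(3) flip: filtermap_filter_append[OF subst_letter_append])
    ultimately have "p \<odot> ?T l = p" by (intro p_right ultrafilter_filtermap l(2))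
    \<comment> \<open>With \<open>l \<odot> p = l\<close> this is
      \<open>l \<odot> ?T l = l \<odot> p \<odot> ?T l = l \<odot> p = l\<close>.\<close>
    then show ?thesis by (metis lp filter_append_assoc)
  qed
  moreover have "l \<le> principal (left_variable_words k)" using l(1) by (simp add: V_def)
  ultimately show thesis using that l(2) by blast
qed

section \<open>Generic sequences of variable words\<close>

text \<open>\<open>map2\<close> stops at the shorter list. A word \<open>s\<close> shorter than
  \<open>vs\<close> therefore reaches the node at level \<open>length s\<close>, and one map on
  words of bounded length parametrizes a whole Carlson--Simpson tree.\<close>

definition inst :: "nat option list list \<Rightarrow> nat list \<Rightarrow> nat list"
  where "inst vs s = concat (map2 subst_var vs s)"

definition inst_var :: "nat option list list \<Rightarrow> nat option list \<Rightarrow> nat option list"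
  where "inst_var vs u = concat (map2 (\<lambda>v e. subst_letter e v) vs u)"

text \<open>Composition of embeddings: each \<open>u\<close> consumes as many entries of
  \<open>vs\<close> as it has letters and merges them into one variable word.\<close>

fun compose :: "nat option list list \<Rightarrow> nat option list list \<Rightarrow> nat option list list" where
  "compose vs [] = []"
| "compose vs (u # us) = inst_var (take (length u) vs) u # compose (drop (length u) vs) us"

lemma inst_simps [simp]:
  "inst [] s = []" "inst vs [] = []" "inst (v # vs) (a # s) = subst_var v a @ inst vs s"
  by (simp_all add: inst_def)

lemma inst_var_simps [simp]:
  "inst_var [] s = []" "inst_var vs [] = []" "inst_var (v # vs) (a # s) = subst_letter a v @ inst_var vs s"
  by (simp_all add: inst_var_def)

lemma subst_var_simps [simp]:
  "subst_var [] a = []" "subst_var (u @ v) a = subst_var u a @ subst_var v a"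
  "subst_var (None # v) a = a # subst_var v a" "subst_var (Some b # v) a = b # subst_var v a"
  "subst_var (map Some s) a = s" "subst_var (replicate n None) a = replicate n a"
  "subst_var (replicate n (Some b)) a = replicate n b" "length (subst_var v a) = length v"
  by (auto simp: subst_var_def intro: map_idI)

lemma subst_var_Cons: "subst_var (e # v) a = (case e of None \<Rightarrow> a | Some b \<Rightarrow> b) # subst_var v a"
  by (simp add: subst_var_def)

lemma inst_take: "length s \<le> m \<Longrightarrow> inst (take m vs) s = inst vs s"
  by (induction vs s arbitrary: m rule: list_induct2') (auto simp: take_Cons split: nat.splits)

lemma inst_split: "inst vs (s @ s') = inst (take (length s) vs) s @ inst (drop (length s) vs) s'"
  by (induction s arbitrary: vs) (case_tac vs; simp)+

lemma length_inst: "length s \<le> length vs \<Longrightarrow> length (inst vs s) = length (concat (take (length s) vs))"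
  by (induction vs s rule: list_induct2') auto

lemma subst_var_subst_letter:
  "subst_var (subst_letter e v) a = subst_var v (case e of None \<Rightarrow> a | Some b \<Rightarrow> b)"
  by (auto simp: subst_var_def subst_letter_def split: option.splits)

lemma subst_var_inst_var: "length vs = length u \<Longrightarrow> subst_var (inst_var vs u) a = inst vs (subst_var u a)"
  by (induction vs u rule: list_induct2) (auto simp: subst_var_subst_letter subst_var_Cons)

lemma inst_compose:
  assumes "length (concat us) \<le> length vs" "length s \<le> length us"
  shows "inst (compose vs us) s = inst vs (inst us s)"
  using assms
proof (induction us arbitrary: vs s)
  case (Cons u us)
  show ?case
  proof (cases s)
    case s: (Cons a s')
    have "inst vs (inst (u # us) s) = inst (take (length u) vs) (subst_var u a) @ inst (drop (length u) vs) (inst us s')"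
      using inst_split[of vs "subst_var u a"] by (simp add: s)
    also have "inst (take (length u) vs) (subst_var u a) = subst_var (inst_var (take (length u) vs) u) a"
      using Cons.prems by (intro subst_var_inst_var[symmetric]) simp
    also have "inst (drop (length u) vs) (inst us s') = inst (compose (drop (length u) vs) us) s'"
      using Cons.prems s by (intro Cons.IH[symmetric]) auto
    finally show ?thesis by (simp add: s)
  qed simp
qed simp

section \<open>Fubini powers of an ultrafilter and their self-similarity\<close>

text \<open>The \<open>m\<close>-fold Fubini power of \<open>l\<close>: the first variable word is
  chosen first, and the later ones may depend on it.\<close>

primrec generic :: "nat option list filter \<Rightarrow> nat \<Rightarrow> nat option list list filter" where
  "generic l 0 = principal {[]}"
| "generic l (Suc m) = filtermap (\<lambda>v. [v]) l \<odot> generic l m"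

lemma eventually_generic_Suc:
  "eventually P (generic l (Suc m)) \<longleftrightarrow> (\<forall>\<^sub>F v in l. \<forall>\<^sub>F vs in generic l m. P (v # vs))"
  by (simp add: eventually_filter_append eventually_filtermap)

lemma generic_add: "generic l (a + b) = generic l a \<odot> generic l b"
  by (induction a) (simp_all add: filter_append_assoc)

lemma ultrafilter_generic: "ultrafilter l \<Longrightarrow> ultrafilter (generic l m)"
  by (induction m) (simp_all add: ultrafilter_principal_singleton ultrafilter_filter_append ultrafilter_filtermap)

lemma eventually_generic:
  assumes "eventually (\<lambda>v. v \<in> V) l"
  shows "\<forall>\<^sub>F vs in generic l m. length vs = m \<and> set vs \<subseteq> V"
proof (induction m)
  case (Suc m)
  show ?case unfolding eventually_generic_Suc using assms
    by eventually_elim (use Suc in \<open>auto elim: eventually_mono\<close>)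
qed (simp add: eventually_principal)

text \<open>The ignored tail is quantified last, and properness of its filter removes the
  quantifier. This makes the limit law independent of how many generic words are drawn.\<close>

lemma filtermap_take_generic:
  assumes "ultrafilter l"
  shows "filtermap (take a) (generic l (a + b)) = generic l a"
proof -
  have "eventually P (generic l a \<odot> generic l b) \<longleftrightarrow> eventually Q (generic l a)"
    if "\<And>s t. length s = a \<Longrightarrow> P (s @ t) \<longleftrightarrow> Q s" for P Q
  proof -
    have "\<forall>\<^sub>F s in generic l a. (\<forall>\<^sub>F t in generic l b. P (s @ t)) \<longleftrightarrow> Q s"
      using eventually_generic[of UNIV l a] ultrafilter_not_bot[OF ultrafilter_generic[OF assms]]
      by (auto elim!: eventually_mono simp: that)
    then show ?thesis unfolding eventually_filter_append by (rule eventually_cong) simp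
  qed
  then show ?thesis by (simp add: filter_eq_iff eventually_filtermap generic_add)
qed

context
  fixes k l
  assumes absorb: "\<And>e. e \<in> letters k \<Longrightarrow> l \<odot> filtermap (subst_letter e) l = l"
begin

lemma filtermap_inst_var_Cons:
  "filtermap (\<lambda>vs. inst_var vs (e # u)) (generic l (Suc m)) =
   filtermap (subst_letter e) l \<odot> filtermap (\<lambda>vs. inst_var vs u) (generic l m)"
  by (simp add: filter_eq_iff eventually_filter_append eventually_filtermap)

lemma filter_append_inst_var:
  "set u \<subseteq> letters k \<Longrightarrow> l \<odot> filtermap (\<lambda>vs. inst_var vs u) (generic l (length u)) = l"
proof (induction u)
  case (Cons e u)
  then show ?case
    unfolding list.size(4) add_Suc_right add_0_right filtermap_inst_var_Cons
    by (simp add: absorb flip: filter_append_assoc)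
qed (simp add: filtermap_principal)

text \<open>The leading variable of \<open>u\<close> contributes the factor \<open>l\<close>; each
  further letter \<open>e\<close> contributes \<open>filtermap (subst_letter e) l\<close>, which
  \<open>l\<close> absorbs. This is the reason for working with left variable words.\<close>

lemma filtermap_inst_var:
  assumes "u \<in> left_variable_words k"
  shows "filtermap (\<lambda>vs. inst_var vs u) (generic l (length u)) = l"
proof -
  obtain u' where u: "u = None # u'" "set u' \<subseteq> letters k"
    using assms by (cases u) (auto simp: left_variable_words_def letters_def)
  show ?thesis
    unfolding u list.size(4) add_Suc_right add_0_right filtermap_inst_var_Cons
    by (simp add: filter_append_inst_var u filtermap_ident)
qed

text \<open>Disjoint blocks of a generic sequence are merged separately, and each merged block is
  again \<open>l\<close>-generic. Invariance of the limit law rests on this.\<close>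

lemma filtermap_compose:
  assumes "set us \<subseteq> left_variable_words k"
  shows "filtermap (\<lambda>vs. compose vs us) (generic l (length (concat us))) = generic l (length us)"
  using assms
proof (induction us)
  case (Cons u us)
  let ?n = "length (concat us)"
  have "eventually P (filtermap (\<lambda>vs. compose vs (u # us)) (generic l (length (concat (u # us))))) \<longleftrightarrow>
        eventually P (generic l (length (u # us)))" for P
  proof -
    define Q where "Q v \<longleftrightarrow> (\<forall>\<^sub>F vs in generic l (length us). P (v # vs))" for v
    have "eventually P (filtermap (\<lambda>vs. compose vs (u # us)) (generic l (length (concat (u # us))))) \<longleftrightarrow>
      (\<forall>\<^sub>F s in generic l (length u). \<forall>\<^sub>F t in generic l ?n. P (compose (s @ t) (u # us)))"
      by (simp add: eventually_filtermap generic_add eventually_filter_append)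
    also have "\<dots> \<longleftrightarrow> (\<forall>\<^sub>F s in generic l (length u). \<forall>\<^sub>F t in generic l ?n. P (inst_var s u # compose t us))"
      by (rule eventually_cong[OF eventually_generic[of UNIV]]) auto
    also have "\<dots> \<longleftrightarrow> (\<forall>\<^sub>F s in generic l (length u). Q (inst_var s u))"
      using Cons by (simp add: Q_def eventually_filtermap flip: Cons.IH)
    also have "\<dots> \<longleftrightarrow> (\<forall>\<^sub>F v in filtermap (\<lambda>vs. inst_var vs u) (generic l (length u)). Q v)"
      by (simp add: eventually_filtermap)
    also have "\<dots> \<longleftrightarrow> eventually Q l" using Cons.prems by (simp add: filtermap_inst_var)
    finally show ?thesis
      unfolding list.size(4) add_Suc_right add_0_right eventually_generic_Suc Q_def .
  qed
  then show ?case by (simp add: filter_eq_iff)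
qed (simp add: filtermap_principal)

end

lemma ultrafilter_limit:
  fixes f :: "'a \<Rightarrow> real"
  assumes "ultrafilter U" "\<forall>\<^sub>F i in U. f i \<in> {a..b}"
  obtains L where "L \<in> {a..b}" "(f \<longlongrightarrow> L) U"
proof -
  have uf: "ultrafilter (filtermap f U)" using assms(1) by (rule ultrafilter_filtermap)
  have "\<exists>x\<in>{a..b}. inf (nhds x) (filtermap f U) \<noteq> bot"
    using compact_Icc[of a b] assms(2) ultrafilter_not_bot[OF uf]
    by (auto simp: compact_filter eventually_filtermap)
  then obtain x where x: "x \<in> {a..b}" "inf (nhds x) (filtermap f U) \<noteq> bot" by blast
  then have "inf (nhds x) (filtermap f U) = filtermap f U"
    using ultrafilter_le_eq[OF uf] by simp
  then have "filtermap f U \<le> nhds x" by (metis inf.cobounded1)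
  then show thesis using that x(1) by (simp add: filterlim_def)
qed

section \<open>Laws of random sets\<close>

text \<open>\<open>law T \<nu>\<close>: \<open>\<nu> G\<close> is the probability that some random subset of \<open>T\<close> contains \<open>G\<close>.\<close>

definition law :: "'a set \<Rightarrow> ('a set \<Rightarrow> real) \<Rightarrow> bool"
  where "law T \<nu> \<longleftrightarrow> (\<exists>q. (\<forall>S\<in>Pow T. 0 \<le> q S) \<and> sum q (Pow T) = 1 \<and>
           (\<forall>G\<in>Pow T. \<nu> G = sum q {S \<in> Pow T. G \<subseteq> S}))"

lemma law_cong: "(\<And>G. G \<subseteq> T \<Longrightarrow> \<nu> G = \<nu>' G) \<Longrightarrow> law T \<nu> \<longleftrightarrow> law T \<nu>'"
  by (simp add: law_def)

text \<open>The random set is replaced by its preimage under \<open>\<phi>\<close>: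
  \<open>g S\<close> is that preimage, and \<open>q'\<close> is the distribution of
  \<open>g\<close>.\<close>

lemma law_image:
  assumes "law T \<nu>" "finite T" "finite T'" "\<phi> ` T' \<subseteq> T"
  shows "law T' (\<lambda>G. \<nu> (\<phi> ` G))"
proof -
  obtain q where q: "\<And>S. S \<in> Pow T \<Longrightarrow> 0 \<le> q S" "sum q (Pow T) = 1"
    "\<And>G. G \<in> Pow T \<Longrightarrow> \<nu> G = sum q {S \<in> Pow T. G \<subseteq> S}"
    using assms(1) unfolding law_def by blast
  define g where "g S = {t \<in> T'. \<phi> t \<in> S}" for S
  define q' where "q' S' = sum q {S \<in> Pow T. g S = S'}" for S'
  have "0 \<le> q' S'" for S' unfolding q'_def by (intro sum_nonneg q) auto
  moreover have "sum q' (Pow T') = 1"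
    unfolding q'_def by (subst sum.group) (use assms q in \<open>auto simp: g_def\<close>)
  moreover have "\<nu> (\<phi> ` G) = sum q' {S \<in> Pow T'. G \<subseteq> S}" if G: "G \<in> Pow T'" for G
  proof -
    have "\<nu> (\<phi> ` G) = sum q {S \<in> Pow T. \<phi> ` G \<subseteq> S}" using G assms by (intro q) auto
    also have "\<dots> = (\<Sum>S'\<in>{S \<in> Pow T'. G \<subseteq> S}. sum q {S \<in> {S \<in> Pow T. \<phi> ` G \<subseteq> S}. g S = S'})"
      by (subst sum.group) (use assms G in \<open>auto simp: g_def\<close>)
    also have "\<dots> = sum q' {S \<in> Pow T'. G \<subseteq> S}"
      unfolding q'_def by (intro sum.cong refl arg_cong2[of _ _ _ _ sum]) (auto simp: g_def)
    finally show ?thesis .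
  qed
  ultimately show ?thesis unfolding law_def by blast
qed

lemma law_subset:
  assumes "law T \<nu>" "finite T" "T' \<subseteq> T"
  shows "law T' \<nu>"
  using law_image[OF assms(1,2) finite_subset[OF assms(3,2)], of id] assms(3) by simp

text \<open>For finite \<open>T\<close> a law is given by finitely many weights in
  \<open>[0,1]\<close> of total mass 1. The weights converge along an ultrafilter, and the values at
  \<open>G\<close> are finite sums of them.\<close>

lemma law_Lim:
  assumes "ultrafilter U" "\<forall>\<^sub>F i in U. law T (f i)" "finite T"
  shows law_Lim_law: "law T (\<lambda>G. Lim U (\<lambda>i. f i G))"
    and law_Lim_tendsto: "G \<subseteq> T \<Longrightarrow> ((\<lambda>i. f i G) \<longlongrightarrow> Lim U (\<lambda>i. f i G)) U"
proof -
  define Q where "Q i q \<longleftrightarrow> (\<forall>S\<in>Pow T. 0 \<le> q S) \<and> sum q (Pow T) = 1 \<and>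
    (\<forall>G\<in>Pow T. f i G = sum q {S \<in> Pow T. G \<subseteq> S})" for i and q :: "'b set \<Rightarrow> real"
  define q where "q i = (SOME q. Q i q)" for i
  have q: "\<forall>\<^sub>F i in U. Q i (q i)"
    using assms(2)
  proof eventually_elim
    case (elim i)
    then have "\<exists>q. Q i q" by (simp add: law_def Q_def)
    then show ?case unfolding q_def by (rule someI_ex)
  qed
  have "\<exists>L. 0 \<le> L \<and> ((\<lambda>i. q i S) \<longlongrightarrow> L) U" if "S \<in> Pow T" for S
  proof -
    have "\<forall>\<^sub>F i in U. q i S \<in> {0..1}"
      using q
    proof eventually_elim
      case (elim i)
      then have "q i S \<le> sum (q i) (Pow T)"
        using that assms(3) by (intro member_le_sum) (auto simp: Q_def)
      then show ?case using elim that by (auto simp: Q_def)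
    qed
    then obtain L where "L \<in> {0..1}" "((\<lambda>i. q i S) \<longlongrightarrow> L) U"
      using ultrafilter_limit[OF assms(1), of "\<lambda>i. q i S" 0 1] by blast
    then show ?thesis by auto
  qed
  then obtain r where r: "\<And>S. S \<in> Pow T \<Longrightarrow> 0 \<le> r S"
    "\<And>S. S \<in> Pow T \<Longrightarrow> ((\<lambda>i. q i S) \<longlongrightarrow> r S) U" by metis
  have U: "U \<noteq> bot" using assms(1) by (rule ultrafilter_not_bot)
  have lim: "((\<lambda>i. f i G) \<longlongrightarrow> sum r {S \<in> Pow T. G \<subseteq> S}) U" if "G \<in> Pow T" for G
  proof -
    have "((\<lambda>i. sum (q i) {S \<in> Pow T. G \<subseteq> S}) \<longlongrightarrow> sum r {S \<in> Pow T. G \<subseteq> S}) U"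
      by (intro tendsto_sum r) auto
    then show ?thesis
      by (rule Lim_transform_eventually) (use q in \<open>eventually_elim, use that in \<open>auto simp: Q_def\<close>\<close>)
  qed
  then have Lim: "Lim U (\<lambda>i. f i G) = sum r {S \<in> Pow T. G \<subseteq> S}" if "G \<in> Pow T" for G
    using that U by (intro tendsto_Lim)
  then show "((\<lambda>i. f i G) \<longlongrightarrow> Lim U (\<lambda>i. f i G)) U" if "G \<subseteq> T" using lim that by simp
  have "((\<lambda>i. sum (q i) (Pow T)) \<longlongrightarrow> sum r (Pow T)) U" by (intro tendsto_sum r)
  moreover have "((\<lambda>i. sum (q i) (Pow T)) \<longlongrightarrow> 1) U"
    by (rule tendsto_eventually) (use q in \<open>eventually_elim, auto simp: Q_def\<close>)
  ultimately have "sum r (Pow T) = 1" using U tendsto_unique by blast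
  with r Lim show "law T (\<lambda>G. Lim U (\<lambda>i. f i G))" unfolding law_def by blast
qed

lemma sets_trace:
  assumes "finite T" "\<And>w. w \<in> T \<Longrightarrow> A w \<in> sets M"
  shows "{x \<in> space M. {w \<in> T. x \<in> A w} = S} \<in> sets M"
proof (cases "S \<subseteq> T")
  case True
  then have "{x \<in> space M. {w \<in> T. x \<in> A w} = S}
      = {x \<in> space M. \<forall>w\<in>T. if w \<in> S then x \<in> A w else x \<in> space M - A w}" by auto
  also have "\<dots> \<in> sets M"
  proof (intro sets.sets_Collect_finite_All assms(1))
    fix w assume "w \<in> T"
    then have "A w \<in> sets M" by (rule assms(2))
    then have "{x \<in> space M. x \<in> A w} \<in> sets M" "{x \<in> space M. x \<in> space M - A w} \<in> sets M"
      by (simp_all add: Collect_conj_eq sets.sets_Collect_neg)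
    then show "{x \<in> space M. if w \<in> S then x \<in> A w else x \<in> space M - A w} \<in> sets M" by simp
  qed
  finally show ?thesis .
next
  case False
  then have "{x \<in> space M. {w \<in> T. x \<in> A w} = S} = {}" by blast
  then show ?thesis by (simp only: sets.empty_sets)
qed

lemma law_measure:
  assumes "prob_space M" "finite T" "\<And>w. w \<in> T \<Longrightarrow> A w \<in> sets M"
  shows "law T (\<lambda>G. measure M {x \<in> space M. \<forall>w\<in>G. x \<in> A w})"
proof -
  interpret prob_space M by fact
  define E where "E S = {x \<in> space M. {w \<in> T. x \<in> A w} = S}" for S
  have E: "E S \<in> events" for S unfolding E_def by (intro sets_trace assms)
  have disj: "disjoint_family_on E X" for X by (auto simp: disjoint_family_on_def E_def)
  have *: "prob {x \<in> space M. \<forall>w\<in>G. x \<in> A w} = (\<Sum>S\<in>{S \<in> Pow T. G \<subseteq> S}. prob (E S))" if "G \<in> Pow T" for G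
  proof -
    have "{x \<in> space M. \<forall>w\<in>G. x \<in> A w} = (\<Union>S\<in>{S \<in> Pow T. G \<subseteq> S}. E S)"
      using that by (auto simp: E_def)
    then show ?thesis
      using E assms(2) by (simp add: finite_measure_finite_Union[OF _ _ disj] image_subset_iff)
  qed
  moreover have "(\<Sum>S\<in>Pow T. prob (E S)) = 1" using *[of "{}"] prob_space by (simp add: Pow_def)
  ultimately show ?thesis
    unfolding law_def by (intro exI[of _ "\<lambda>S. prob (E S)"]) auto
qed

text \<open>Later second-moment arguments see the law only as a normalized positive linear
  functional, without its weights.\<close>

lemma law_expectation:
  assumes "law T \<nu>" "finite T"
  obtains E :: "('a set \<Rightarrow> real) \<Rightarrow> real" where
    "\<And>f g. E (\<lambda>S. f S + g S) = E f + E g" "\<And>c f. E (\<lambda>S. c * f S) = c * E f"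
    "\<And>f g. (\<And>S. f S \<le> g S) \<Longrightarrow> E f \<le> E g" "E (\<lambda>_. 1) = 1"
    "\<And>G. G \<subseteq> T \<Longrightarrow> E (\<lambda>S. of_bool (G \<subseteq> S)) = \<nu> G"
proof -
  obtain q where q: "\<And>S. S \<in> Pow T \<Longrightarrow> 0 \<le> q S" "sum q (Pow T) = 1"
    "\<And>G. G \<in> Pow T \<Longrightarrow> \<nu> G = sum q {S \<in> Pow T. G \<subseteq> S}"
    using assms(1) unfolding law_def by blast
  show thesis
  proof (rule that[of "\<lambda>f. \<Sum>S\<in>Pow T. q S * f S"])
    fix f g :: "'a set \<Rightarrow> real" and c
    show "(\<Sum>S\<in>Pow T. q S * (f S + g S)) = (\<Sum>S\<in>Pow T. q S * f S) + (\<Sum>S\<in>Pow T. q S * g S)"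
      by (simp add: distrib_left sum.distrib)
    show "(\<Sum>S\<in>Pow T. q S * (c * f S)) = c * (\<Sum>S\<in>Pow T. q S * f S)"
      by (simp add: sum_distrib_left ac_simps)
    show "(\<Sum>S\<in>Pow T. q S * f S) \<le> (\<Sum>S\<in>Pow T. q S * g S)" if "\<And>S. f S \<le> g S"
      by (intro sum_mono mult_left_mono that q)
    show "(\<Sum>S\<in>Pow T. q S * 1) = 1" using q(2) by simp
  next
    fix G assume "G \<subseteq> T"
    then show "(\<Sum>S\<in>Pow T. q S * of_bool (G \<subseteq> S)) = \<nu> G"
      using q(3)[of G] sum.inter_filter[of "Pow T" q "\<lambda>S. G \<subseteq> S"] assms(2)
      by (simp add: of_bool_def if_distrib cong: if_cong)
  qed
qed

section \<open>Laws invariant under embeddings\<close>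

definition words :: "nat \<Rightarrow> nat \<Rightarrow> nat list set"
  where "words k m = {w \<in> lists {1..k}. length w \<le> m}"

lemma finite_words [simp]: "finite (words k m)"
proof -
  have "words k m = {w. set w \<subseteq> {1..k} \<and> length w \<le> m}" by (auto simp: words_def)
  then show ?thesis by (simp add: finite_lists_length_le)
qed

lemma finite_subset_words:
  assumes "finite G" "G \<subseteq> lists {1..k}"
  obtains m where "G \<subseteq> words k m"
proof
  show "G \<subseteq> words k (Max (insert 0 (length ` G)))" using assms by (auto simp: words_def)
qed

lemma image_append_words: "h \<in> lists A \<Longrightarrow> G \<subseteq> lists A \<Longrightarrow> (@) h ` G \<subseteq> lists A"
  by (metis (no_types) append_in_lists_conv image_subsetI subsetD)

text \<open>Words of length exactly \<open>i\<close> already receive \<open>t\<close>: the map is an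
  embedding in which \<open>t\<close> is the constant tail of the \<open>i\<close>-th variable word,
  or the root if \<open>i = 0\<close>, so the node at level \<open>i\<close> carries it.\<close>

definition insert_at :: "nat \<Rightarrow> 'a list \<Rightarrow> 'a list \<Rightarrow> 'a list"
  where "insert_at i t s = (if length s < i then s else take i s @ t @ drop i s)"

lemma insert_at_short: "length s < i \<Longrightarrow> insert_at i t s = s"
  and insert_at_append: "insert_at (length c) t (c @ s) = c @ t @ s"
  by (simp_all add: insert_at_def)

lemma inst_replicate_append:
  "inst (replicate n [None] @ vs) s = (if length s \<le> n then s else take n s @ inst vs (drop n s))"
  by (induction n arbitrary: s) (case_tac s; simp add: subst_var_def)+

text \<open>The reference chain, with lengths \<open>i\<close> to \<open>i + r - 1\<close>, to which
  sets of words of distinct lengths are reduced.\<close>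

definition ones :: "nat \<Rightarrow> nat \<Rightarrow> nat list set"
  where "ones i r = (\<lambda>j. replicate (i + j) 1) ` {..<r}"

lemma ones_shift: "(@) (replicate i 1) ` ones j r = ones (i + j) r"
  by (simp add: ones_def image_image add.assoc flip: replicate_add)

lemma ones_0_Suc: "ones 0 (Suc r) = insert [] ((@) [1] ` ones 0 r)"
  by (simp add: ones_def lessThan_Suc_eq_insert_0 image_image)

lemma finite_ones [simp]: "finite (ones i r)"
  by (simp add: ones_def)

lemma inj_on_length_ones: "inj_on length (ones i r)"
  by (auto simp: ones_def inj_on_def)

lemma card_ones: "card (ones i r) = r"
  unfolding ones_def by (subst card_image) (auto simp: inj_on_def dest: arg_cong[of _ _ length])

lemma inj_on_length_insert_pair:
  assumes "inj_on length Q" "\<And>q. q \<in> Q \<Longrightarrow> length q < length x" "\<And>q. q \<in> Q \<Longrightarrow> length q < length y"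
    and "length x \<noteq> length y"
  shows "inj_on length (insert x (insert y Q))" "y \<notin> Q" "x \<notin> insert y Q"
proof -
  show "y \<notin> Q" "x \<notin> insert y Q" using assms(2-4) by blast+
  have "length y \<notin> length ` Q" by (metis assms(3) imageE less_irrefl)
  moreover have "length x \<notin> length ` insert y Q" by (metis assms(2,4) imageE insertE less_irrefl)
  ultimately show "inj_on length (insert x (insert y Q))"
    using assms(1) unfolding inj_on_insert by (auto dest: image_eqI)
qed

section \<open>A martingale inequality on a binary tree\<close>

primrec leaf_count :: "'a list \<Rightarrow> 'a list \<Rightarrow> 'a list set \<Rightarrow> nat \<Rightarrow> 'a list \<Rightarrow> 'a list set \<Rightarrow> real" where
  "leaf_count c c' G 0 h S = of_bool ((@) h ` G \<subseteq> S)"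
| "leaf_count c c' G (Suc n) h S = leaf_count c c' G n (h @ c) S + leaf_count c c' G n (h @ c') S"

text \<open>Along a random branch \<open>h\<^sub>0, h\<^sub>1, \<dots>\<close> of the binary tree with steps \<open>c\<close> and \<open>c'\<close>, the signed indicators
  of \<open>h\<^sub>i Q \<subseteq> S\<close>, with the sign given by the step taken at \<open>h\<^sub>i\<close>, are martingale differences.
  \<open>discrepancy\<close> adds up, over all branches, their sum times the indicator of the leaf.\<close>

primrec discrepancy ::
  "'a list \<Rightarrow> 'a list \<Rightarrow> 'a list set \<Rightarrow> 'a list set \<Rightarrow> nat \<Rightarrow> 'a list \<Rightarrow> 'a list set \<Rightarrow> real" where
  "discrepancy c c' Q G 0 h S = 0"
| "discrepancy c c' Q G (Suc n) h S =
     of_bool ((@) h ` Q \<subseteq> S) * (leaf_count c c' G n (h @ c) S - leaf_count c c' G n (h @ c') S)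
     + discrepancy c c' Q G n (h @ c) S + discrepancy c c' Q G n (h @ c') S"

text \<open>Here \<open>z\<close> is the signed sum already collected on the path to
  \<open>h\<close>. At a leaf the bound is the AM-GM inequality
  \<open>z \<le> (s + z\<^sup>2 / s) / 2\<close>; at a branching it is \<open>(z + x)\<^sup>2 + (z -
  x)\<^sup>2 = 2 * z\<^sup>2 + 2 * x\<^sup>2\<close>, which expresses orthogonality. For
  \<open>z = 0\<close> the best \<open>s\<close> is the square root of \<open>n\<close>.\<close>

lemma discrepancy_le:
  assumes "0 < s"
  shows "z * leaf_count c c' G n h S + discrepancy c c' Q G n h S
           \<le> 2 ^ n * (s + (z\<^sup>2 + real n) / s) / 2"
proof (induction n arbitrary: z h)
  case 0
  have "0 \<le> (s - z)\<^sup>2" by simp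
  then have "2 * z * s \<le> s * s + z\<^sup>2" by (simp add: power2_eq_square algebra_simps)
  then have "z \<le> (s + z\<^sup>2 / s) / 2" using assms by (simp add: field_simps)
  moreover have "0 \<le> (s + z\<^sup>2 / s) / 2" using assms by simp
  ultimately show ?case by simp
next
  case (Suc n)
  define x :: real where "x = of_bool ((@) h ` Q \<subseteq> S)"
  have x: "x\<^sup>2 \<le> 1" by (simp add: x_def)
  have "z * leaf_count c c' G (Suc n) h S + discrepancy c c' Q G (Suc n) h S
      = ((z + x) * leaf_count c c' G n (h @ c) S + discrepancy c c' Q G n (h @ c) S)
      + ((z - x) * leaf_count c c' G n (h @ c') S + discrepancy c c' Q G n (h @ c') S)"
    by (simp add: x_def algebra_simps)
  also have "\<dots> \<le> 2 ^ n * (s + ((z + x)\<^sup>2 + real n) / s) / 2 + 2 ^ n * (s + ((z - x)\<^sup>2 + real n) / s) / 2"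
    by (intro add_mono Suc)
  also have "\<dots> = 2 ^ Suc n * (s + (z\<^sup>2 + (x\<^sup>2 + real n)) / s) / 2"
    by (simp add: power2_sum power2_diff add_divide_distrib diff_divide_distrib algebra_simps)
  also have "\<dots> \<le> 2 ^ Suc n * (s + (z\<^sup>2 + real (Suc n)) / s) / 2"
    using assms x by (intro divide_right_mono mult_left_mono add_mono) auto
  finally show ?case .
qed

section \<open>Long sequences of words on one level with all pairs of the same type\<close>

text \<open>For \<open>i < j\<close> the staircases at \<open>i\<close> and \<open>j\<close> agree
  except at positions \<open>i\<close> to \<open>j - 1\<close> of each block, where the first has
  the letter of \<open>u\<close> and the second that of \<open>v\<close>. With a variable in those
  positions the two become instances of \<open>u\<close> and \<open>v\<close>.\<close>

definition stair :: "nat \<Rightarrow> nat \<Rightarrow> 'a list \<Rightarrow> 'a list \<Rightarrow> 'a list"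
  where "stair N i u v = concat (map2 (\<lambda>a b. replicate i b @ replicate (N - i) a) u v)"

lemma set_stair: "set (stair N i u v) \<subseteq> set u \<union> set v"
  by (auto simp: stair_def dest: set_zip_leftD set_zip_rightD split: if_splits)

definition head_block :: "nat \<Rightarrow> 'a list \<Rightarrow> 'a list"
  where "head_block i v = (case v of [] \<Rightarrow> [] | b # _ \<Rightarrow> replicate i b)"

text \<open>The natural block with letters \<open>a\<close>, \<open>b\<close> consists of
  \<open>i\<close> copies of \<open>b\<close>, then \<open>j - i\<close> variables, then
  \<open>N - j\<close> copies of \<open>a\<close>, and does not begin with a variable. Hence its
  constant head is moved to the end of the preceding variable word; the very first head is left to
  the root.\<close>

fun stair_vars :: "nat \<Rightarrow> nat \<Rightarrow> nat \<Rightarrow> nat list \<Rightarrow> nat list \<Rightarrow> nat option list list" where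
  "stair_vars N i j (a # u) (b # v) =
     (replicate (j - i) None @ replicate (N - j) (Some a) @ map Some (head_block i v)) # stair_vars N i j u v"
| "stair_vars N i j u v = []"

lemma inst_stair_vars:
  assumes "length u = length v" "i \<le> j" "j \<le> N"
  shows "head_block i v @ inst (stair_vars N i j u v) u = stair N i u v"
    and "head_block i v @ inst (stair_vars N i j u v) v = stair N j u v"
  using assms(1)
proof (induction u v rule: list_induct2)
  case (Cons a u b v)
  have 0: "replicate (j - i) a @ replicate (N - j) a = replicate (N - i) a"
    using assms(2,3) by (simp flip: replicate_add)
  then have 1: "replicate (j - i) a @ replicate (N - j) a @ w = replicate (N - i) a @ w" for w
    by (metis append_assoc)
  have 3: "replicate i b @ replicate (j - i) b = replicate j b"
    using assms(2,3) by (simp flip: replicate_add)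
  then have 2: "replicate i b @ replicate (j - i) b @ w = replicate j b @ w" for w
    by (metis append_assoc)
  {
    case 1
    show ?case using Cons.IH by (simp add: stair_def head_block_def[of i "b # v"] 0 1)
  next
    case 2
    show ?case using Cons.IH by (simp add: stair_def head_block_def[of i "b # v"] 2 3)
  }
qed (simp_all add: stair_def head_block_def)

lemma stair_vars_left:
  assumes "length u = length v" "i < j" "set u \<subseteq> {1..k}" "set v \<subseteq> {1..k}"
  shows "set (stair_vars N i j u v) \<subseteq> left_variable_words k \<and> length (stair_vars N i j u v) = length u"
  using assms
proof (induction u v rule: list_induct2)
  case (Cons a u b v)
  have "replicate (j - i) (None :: nat option) = None # replicate (j - i - 1) None"
    using \<open>i < j\<close> by (cases "j - i") auto
  moreover have "set (head_block i v) \<subseteq> {1..k}"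
    using Cons.prems by (auto simp: head_block_def split: list.splits)
  ultimately show ?case
    using Cons by (auto simp: left_variable_words_def)
qed simp

lemma double_sum_le:
  fixes f :: "nat \<Rightarrow> nat \<Rightarrow> real"
  assumes "\<And>i j. i < N \<Longrightarrow> j < N \<Longrightarrow> i \<noteq> j \<Longrightarrow> f i j \<le> b" "\<And>i. i < N \<Longrightarrow> f i i \<le> 1" "0 \<le> b"
  shows "(\<Sum>i<N. \<Sum>j<N. f i j) \<le> (real N)\<^sup>2 * b + real N"
proof -
  have "(\<Sum>i<N. \<Sum>j<N. f i j) \<le> (\<Sum>i<N. \<Sum>j<N. b + of_bool (j = i))"
    using assms by (intro sum_mono) (force simp: of_bool_def intro: add_increasing)
  also have "\<dots> = (real N)\<^sup>2 * b + real N"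
    by (simp add: sum.distrib power2_eq_square of_bool_def algebra_simps)
  finally show ?thesis .
qed

text \<open>Every second moment of a sum of \<open>N\<close> indicators below has about
  \<open>N\<^sup>2\<close> off-diagonal terms of interest and a diagonal of order \<open>N\<close>;
  this lemma discards the diagonal.\<close>

lemma nonneg_of_linear_error:
  fixes x :: real
  assumes "\<And>N::nat. 0 \<le> (real N)\<^sup>2 * x + C * real N"
  shows "0 \<le> x"
proof (rule ccontr)
  assume "\<not> 0 \<le> x"
  then obtain N :: nat where "\<bar>C\<bar> + 1 < real N * (- x)"
    using ex_less_of_nat_mult[of "- x" "\<bar>C\<bar> + 1"] by auto
  moreover from this have N: "0 < real N" by (cases N) auto
  moreover have "0 \<le> real N * (real N * x + C)" using assms[of N] by (simp add: power2_eq_square algebra_simps)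
  then have "0 \<le> real N * x + C" using N by (simp add: zero_le_mult_iff)
  ultimately show False by simp
qed

section \<open>Consequences of exact invariance\<close>

text \<open>The bound on the lengths in \<open>embed\<close> keeps \<open>inst\<close> from
  truncating the words of \<open>G\<close>.\<close>

locale word_law =
  fixes k :: nat and \<nu> :: "nat list set \<Rightarrow> real" and \<epsilon> :: real
  assumes k_pos: "1 \<le> k"
    and law_words: "law (words k m) \<nu>"
    and embed: "h \<in> lists {1..k} \<Longrightarrow> set us \<subseteq> left_variable_words k \<Longrightarrow> G \<subseteq> words k (length us) \<Longrightarrow>
                  \<nu> ((\<lambda>s. h @ inst us s) ` G) = \<nu> G"
    and lower: "w \<in> lists {1..k} \<Longrightarrow> \<epsilon> \<le> \<nu> {w}"
    and eps_nonneg: "0 \<le> \<epsilon>"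
begin

lemma expectation:
  obtains E :: "(nat list set \<Rightarrow> real) \<Rightarrow> real" where
    "\<And>f g. E (\<lambda>S. f S + g S) = E f + E g" "\<And>c f. E (\<lambda>S. c * f S) = c * E f"
    "\<And>f g. (\<And>S. f S \<le> g S) \<Longrightarrow> E f \<le> E g" "E (\<lambda>_. 1) = 1"
    "\<And>G. G \<subseteq> words k m \<Longrightarrow> E (\<lambda>S. of_bool (G \<subseteq> S)) = \<nu> G"
  using law_expectation[OF law_words finite_words] by blast

lemma prob_bounds:
  assumes "finite G" "G \<subseteq> lists {1..k}"
  shows "0 \<le> \<nu> G" "\<nu> G \<le> 1"
proof -
  obtain m where m: "G \<subseteq> words k m" using finite_subset_words[OF assms] .
  obtain E where E: "\<And>f g. E (\<lambda>S. f S + g S) = E f + E g" "\<And>c f. E (\<lambda>S. c * f S) = c * E f"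
    "\<And>f g. (\<And>S. f S \<le> g S) \<Longrightarrow> E f \<le> E g" "E (\<lambda>_. 1) = 1"
    "\<And>G. G \<subseteq> words k m \<Longrightarrow> E (\<lambda>S. of_bool (G \<subseteq> S)) = \<nu> G"
    using expectation[of m] by blast
  show "\<nu> G \<le> 1" using E(3)[of "\<lambda>S. of_bool (G \<subseteq> S)" "\<lambda>_. 1"] E(4) E(5)[OF m] by simp
  have "E (\<lambda>_. 0) = 0" using E(2)[of 0 "\<lambda>_. 1"] by simp
  then show "0 \<le> \<nu> G" using E(3)[of "\<lambda>_. 0" "\<lambda>S. of_bool (G \<subseteq> S)"] E(5)[OF m] by simp
qed

text \<open>The double sum is the second moment of the combination of the indicators of
  \<open>G i \<subseteq> S\<close> with coefficients \<open>c i\<close>, since the indicators for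
  \<open>G i\<close> and \<open>G j\<close> multiply to that for \<open>G i \<union> G j\<close>. It
  is the form of Cauchy--Schwarz used below.\<close>

lemma positive_definite:
  assumes "finite I" "\<And>i. i \<in> I \<Longrightarrow> finite (G i)" "\<And>i. i \<in> I \<Longrightarrow> G i \<subseteq> lists {1..k}"
  shows "0 \<le> (\<Sum>i\<in>I. \<Sum>j\<in>I. c i * c j * \<nu> (G i \<union> G j))"
proof -
  have "finite (\<Union>i\<in>I. G i)" "(\<Union>i\<in>I. G i) \<subseteq> lists {1..k}" using assms by auto
  then obtain m where m: "(\<Union>i\<in>I. G i) \<subseteq> words k m" by (rule finite_subset_words)
  obtain E where E: "\<And>f g. E (\<lambda>S. f S + g S) = E f + E g" "\<And>c f. E (\<lambda>S. c * f S) = c * E f"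
    "\<And>f g. (\<And>S. f S \<le> g S) \<Longrightarrow> E f \<le> E g" "E (\<lambda>_. 1) = 1"
    "\<And>G. G \<subseteq> words k m \<Longrightarrow> E (\<lambda>S. of_bool (G \<subseteq> S)) = \<nu> G"
    using expectation[of m] by blast
  have E0: "E (\<lambda>_. 0) = 0" using E(2)[of 0 "\<lambda>_. 1"] by simp
  have Esum: "E (\<lambda>S. \<Sum>i\<in>J. f i S) = (\<Sum>i\<in>J. E (f i))" if "finite J" for J :: "'c set" and f
    using that by (induction J) (simp_all add: E0 E(1))
  have "0 = E (\<lambda>_. 0)" by (simp add: E0)
  also have "\<dots> \<le> E (\<lambda>S. (\<Sum>i\<in>I. c i * of_bool (G i \<subseteq> S))\<^sup>2)" by (intro E(3)) simp
  also have "\<dots> = E (\<lambda>S. \<Sum>i\<in>I. \<Sum>j\<in>I. c i * c j * of_bool (G i \<union> G j \<subseteq> S))"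
    by (simp add: power2_eq_square sum_product of_bool_conj ac_simps)
  also have "\<dots> = (\<Sum>i\<in>I. \<Sum>j\<in>I. c i * c j * E (\<lambda>S. of_bool (G i \<union> G j \<subseteq> S)))"
    by (simp only: Esum[OF assms(1)] E(2))
  also have "\<dots> = (\<Sum>i\<in>I. \<Sum>j\<in>I. c i * c j * \<nu> (G i \<union> G j))"
    using m by (intro sum.cong refl arg_cong2[of _ _ _ _ "(*)"] E(5)) auto
  finally show ?thesis .
qed

lemma insert_at_invariant:
  assumes "finite G" "G \<subseteq> lists {1..k}" "t \<in> lists {1..k}"
  shows "\<nu> (insert_at i t ` G) = \<nu> G"
proof -
  obtain m where m: "G \<subseteq> words k m" using finite_subset_words[OF assms(1,2)] .
  show ?thesis
  proof (cases i)
    case 0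
    have "\<nu> ((\<lambda>s. t @ inst (replicate m [None]) s) ` G) = \<nu> G"
      using m assms(3) by (intro embed) (auto simp: left_variable_words_def)
    also have "(\<lambda>s. t @ inst (replicate m [None]) s) ` G = insert_at i t ` G"
      using m inst_replicate_append[of m "[]"] 0
      by (intro image_cong) (auto simp: words_def insert_at_def)
    finally show ?thesis .
  next
    case (Suc j)
    let ?us = "replicate j [None] @ (None # map Some t) # replicate m [None]"
    have "\<nu> ((\<lambda>s. [] @ inst ?us s) ` G) = \<nu> G"
      using m assms(3) by (intro embed) (auto simp: left_variable_words_def words_def)
    also have "(\<lambda>s. [] @ inst ?us s) ` G = insert_at i t ` G"
    proof (intro image_cong refl)
      fix s assume "s \<in> G"
      then have s: "length s \<le> m" using m by (auto simp: words_def)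
      show "[] @ inst ?us s = insert_at i t s"
      proof (cases "length s \<le> j")
        case False
        then have "drop j s = s ! j # drop (Suc j) s" "take (Suc j) s = take j s @ [s ! j]"
          by (simp_all add: Cons_nth_drop_Suc take_Suc_conv_app_nth)
        then show ?thesis
          using False s inst_replicate_append[of m "[]" "drop (Suc j) s"]
          by (simp add: inst_replicate_append insert_at_def Suc)
      qed (simp add: inst_replicate_append insert_at_def Suc)
    qed
    finally show ?thesis .
  qed
qed

lemma prefix_invariant:
  assumes "finite G" "G \<subseteq> lists {1..k}" "h \<in> lists {1..k}"
  shows "\<nu> ((@) h ` G) = \<nu> G"
  using insert_at_invariant[OF assms, of 0] by (simp add: insert_at_def)

text \<open>Inserting \<open>t\<close> at level \<open>length c\<close> fixes the shorter words of
  \<open>Q\<close>.\<close>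

lemma pad_invariant:
  assumes "finite Q" "Q \<subseteq> lists {1..k}" "finite G" "G \<subseteq> lists {1..k}"
    and "c \<in> lists {1..k}" "t \<in> lists {1..k}" "\<And>q. q \<in> Q \<Longrightarrow> length q < length c"
  shows "\<nu> (Q \<union> (@) (c @ t) ` G) = \<nu> (Q \<union> (@) c ` G)"
proof -
  have "insert_at (length c) t ` Q = id ` Q"
    by (intro image_cong refl) (simp add: insert_at_short assms)
  then have "insert_at (length c) t ` (Q \<union> (@) c ` G) = Q \<union> (@) (c @ t) ` G"
    by (simp add: image_Un image_image insert_at_append)
  moreover have "Q \<union> (@) c ` G \<subseteq> lists {1..k}" using assms by (simp add: image_append_words)
  ultimately show ?thesis using insert_at_invariant[of "Q \<union> (@) c ` G" t "length c"] assms by simp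
qed

text \<open>On the binary tree with steps \<open>c\<close> and \<open>c'\<close>, invariance makes
  every node contribute a multiple of the same \<Delta> to the expected discrepancy. This grows
  linearly in the depth, whereas orthogonality allows only its square root.\<close>

lemma tail_le_same_length:
  assumes Q: "finite Q" "Q \<subseteq> lists {1..k}" and G: "finite G" "G \<subseteq> lists {1..k}"
    and c: "c \<in> lists {1..k}" "c' \<in> lists {1..k}" "length c = length c'"
    and short: "\<And>q. q \<in> Q \<Longrightarrow> length q < length c"
  shows "\<nu> (Q \<union> (@) c ` G) \<le> \<nu> (Q \<union> (@) c' ` G)"
proof -
  define \<Delta> where "\<Delta> = \<nu> (Q \<union> (@) c ` G) - \<nu> (Q \<union> (@) c' ` G)"
  obtain g where g: "G \<subseteq> words k g" using finite_subset_words[OF G] .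
  have "0 \<le> (real N)\<^sup>2 * (- \<Delta>) + 2 * real N" for N :: nat
  proof (cases "N = 0")
    case False
    define d where "d = length c"
    \<comment> \<open>Room for \<open>N\<^sup>2\<close> steps of length \<open>d\<close> followed by
      a word of \<open>G\<close>.\<close>
    define m where "m = N\<^sup>2 * d + g"
    obtain E where E: "\<And>f g. E (\<lambda>S. f S + g S) = E f + E g" "\<And>c f. E (\<lambda>S. c * f S) = c * E f"
      "\<And>f g. (\<And>S. f S \<le> g S) \<Longrightarrow> E f \<le> E g" "E (\<lambda>_. 1) = 1"
      "\<And>G. G \<subseteq> words k m \<Longrightarrow> E (\<lambda>S. of_bool (G \<subseteq> S)) = \<nu> G"
      using expectation[of m] by blast
    have E0: "E (\<lambda>_. 0) = 0" using E(2)[of 0 "\<lambda>_. 1"] by simp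
    have Ediff: "E (\<lambda>S. f S - h S) = E f - E h" for f h
      using E(1)[of f "\<lambda>S. - 1 * h S"] E(2)[of "- 1" h] by simp
    \<comment> \<open>Each of the \<open>2 ^ n\<close> leaves contributes the same value:
      \<open>prefix_invariant\<close> removes \<open>p\<close>, and \<open>pad_invariant\<close>
      removes whatever follows \<open>b\<close>.\<close>
    have leaf: "E (\<lambda>S. of_bool ((@) p ` Q \<subseteq> S) * leaf_count c c' G n (p @ b @ r) S) = 2 ^ n * \<nu> (Q \<union> (@) b ` G)"
      if "b \<in> {c, c'}" "p \<in> lists {1..k}" "r \<in> lists {1..k}" "length p + d + length r + n * d + g \<le> m" for b p r n
      using that(3,4)
    proof (induction n arbitrary: r)
      case 0
      have b: "b \<in> lists {1..k}" "length b = d" using c that(1) by (auto simp: d_def)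
      have "E (\<lambda>S. of_bool ((@) p ` Q \<subseteq> S) * leaf_count c c' G 0 (p @ b @ r) S)
          = E (\<lambda>S. of_bool ((@) p ` (Q \<union> (@) (b @ r) ` G) \<subseteq> S))"
        by (simp add: image_Un image_image of_bool_conj)
      also have "\<dots> = \<nu> ((@) p ` (Q \<union> (@) (b @ r) ` G))"
        using 0 that(2) b Q(2) short g by (intro E(5)) (fastforce simp: words_def d_def)
      also have "\<dots> = \<nu> (Q \<union> (@) (b @ r) ` G)"
        using 0 that(2) b Q G by (intro prefix_invariant Un_least image_append_words) auto
      also have "\<dots> = \<nu> (Q \<union> (@) b ` G)"
        using 0 b Q G short by (intro pad_invariant) (auto simp: d_def)
      finally show ?case by simp
    next
      case (Suc n)
      have "E (\<lambda>S. of_bool ((@) p ` Q \<subseteq> S) * leaf_count c c' G (Suc n) (p @ b @ r) S)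
          = E (\<lambda>S. of_bool ((@) p ` Q \<subseteq> S) * leaf_count c c' G n (p @ b @ r @ c) S
                 + of_bool ((@) p ` Q \<subseteq> S) * leaf_count c c' G n (p @ b @ r @ c') S)"
        by (simp add: distrib_left)
      also have "\<dots> = 2 ^ n * \<nu> (Q \<union> (@) b ` G) + 2 ^ n * \<nu> (Q \<union> (@) b ` G)"
        unfolding E(1) using Suc.prems c by (intro arg_cong2[of _ _ _ _ "(+)"] Suc.IH) (auto simp: d_def)
      finally show ?case by simp
    qed
    \<comment> \<open>Depth \<open>i\<close> has \<open>2 ^ i\<close> nodes, each contributing
      \<open>2 ^ (n - 1 - i) * \<Delta>\<close>, so each of the \<open>n\<close> depths adds
      \<open>2 ^ (n - 1) * \<Delta>\<close>.\<close>
    have disc: "2 * E (discrepancy c c' Q G n h) = real n * 2 ^ n * \<Delta>"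
      if "h \<in> lists {1..k}" "length h + n * d + g \<le> m" for n h
      using that
    proof (induction n arbitrary: h)
      case 0
      have "discrepancy c c' Q G 0 h = (\<lambda>_. 0)" by (simp add: fun_eq_iff)
      then show ?case by (simp add: E0)
    next
      case (Suc n)
      let ?I = "\<lambda>S. of_bool ((@) h ` Q \<subseteq> S) :: real"
      have "discrepancy c c' Q G (Suc n) h = (\<lambda>S. ?I S * leaf_count c c' G n (h @ c @ []) S
           - ?I S * leaf_count c c' G n (h @ c' @ []) S
           + discrepancy c c' Q G n (h @ c) S + discrepancy c c' Q G n (h @ c') S)"
        by (simp add: fun_eq_iff right_diff_distrib)
      then have "E (discrepancy c c' Q G (Suc n) h) = E (\<lambda>S. ?I S * leaf_count c c' G n (h @ c @ []) S)
          - E (\<lambda>S. ?I S * leaf_count c c' G n (h @ c' @ []) S)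
          + E (discrepancy c c' Q G n (h @ c)) + E (discrepancy c c' Q G n (h @ c'))"
        by (simp only: E(1) Ediff)
      also have "E (\<lambda>S. ?I S * leaf_count c c' G n (h @ c @ []) S) = 2 ^ n * \<nu> (Q \<union> (@) c ` G)"
        using Suc.prems by (intro leaf) auto
      also have "E (\<lambda>S. ?I S * leaf_count c c' G n (h @ c' @ []) S) = 2 ^ n * \<nu> (Q \<union> (@) c' ` G)"
        using Suc.prems by (intro leaf) auto
      finally have "2 * E (discrepancy c c' Q G (Suc n) h) = 2 ^ Suc n * \<Delta>
          + 2 * E (discrepancy c c' Q G n (h @ c)) + 2 * E (discrepancy c c' Q G n (h @ c'))"
        by (simp add: \<Delta>_def algebra_simps del: discrepancy.simps)
      also have "\<dots> = 2 ^ Suc n * \<Delta> + real n * 2 ^ n * \<Delta> + real n * 2 ^ n * \<Delta>"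
        using Suc.prems c by (intro arg_cong2[of _ _ _ _ "(+)"] refl Suc.IH) (auto simp: d_def)
      finally show ?case by (simp add: algebra_simps del: discrepancy.simps)
    qed
    \<comment> \<open>With depth \<open>N\<^sup>2\<close> and \<open>s = N\<close> the two terms of
      \<open>discrepancy_le\<close> balance, which leaves
      \<open>N\<^sup>2 * \<Delta> \<le> 2 * N\<close>.\<close>
    let ?n = "N\<^sup>2"
    have "E (discrepancy c c' Q G ?n []) \<le> E (\<lambda>S. 2 ^ ?n * (real N + real ?n / real N) / 2 * 1)"
    proof (rule E(3))
      fix S
      show "discrepancy c c' Q G ?n [] S \<le> 2 ^ ?n * (real N + real ?n / real N) / 2 * 1"
        using discrepancy_le[where s = "real N" and z = 0 and n = ?n and h = "[]"] False by simp
    qed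
    also have "\<dots> = 2 ^ ?n * (real N + real ?n / real N) / 2" by (simp only: E(2,4))
    finally have "2 * E (discrepancy c c' Q G ?n []) \<le> 2 ^ ?n * (2 * real N)"
      using False by (simp add: power2_eq_square)
    then have "2 ^ ?n * (real ?n * \<Delta>) \<le> 2 ^ ?n * (2 * real N)"
      using disc[of "[]" ?n] by (simp add: m_def ac_simps)
    then show ?thesis by (subst (asm) mult_le_cancel_left_pos) auto
  qed simp
  then have "0 \<le> - \<Delta>" by (rule nonneg_of_linear_error)
  then show ?thesis by (simp add: \<Delta>_def)
qed

text \<open>Both words are cut to their common minimal length by \<open>pad_invariant\<close>; on
  one level the preceding inequality applies in both directions.\<close>

lemma tail_invariant:
  assumes Q: "finite Q" "Q \<subseteq> lists {1..k}" and G: "finite G" "G \<subseteq> lists {1..k}"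
    and w: "w \<in> lists {1..k}" "w' \<in> lists {1..k}"
    and short: "\<And>q. q \<in> Q \<Longrightarrow> length q < length w" "\<And>q. q \<in> Q \<Longrightarrow> length q < length w'"
  shows "\<nu> (Q \<union> (@) w ` G) = \<nu> (Q \<union> (@) w' ` G)"
proof -
  define d where "d = min (length w) (length w')"
  have "\<nu> (Q \<union> (@) (take d v @ drop d v) ` G) = \<nu> (Q \<union> (@) (take d v) ` G)" if "v \<in> {w, w'}" for v
    using that assms
    by (intro pad_invariant) (auto simp: d_def dest: in_set_takeD in_set_dropD)
  moreover have "\<nu> (Q \<union> (@) (take d w) ` G) = \<nu> (Q \<union> (@) (take d w') ` G)"
    using assms by (intro antisym tail_le_same_length) (auto simp: d_def dest: in_set_takeD)
  ultimately show ?thesis by simp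
qed

lemma ones_words: "ones i r \<subseteq> lists {1..k}"
  using k_pos by (auto simp: ones_def)

text \<open>The shortest word \<open>w\<close> is peeled off and joins \<open>Q\<close>. By
  induction the rest becomes a chain, which \<open>tail_invariant\<close> moves to start at
  \<open>w @ [1]\<close>. Then \<open>w\<close> heads a chain, and a second move carries all of it
  to level \<open>i\<close>.\<close>

lemma distinct_lengths_aux:
  assumes "finite W" "W \<subseteq> lists {1..k}" "inj_on length W" "card W = r" "\<And>w. w \<in> W \<Longrightarrow> i \<le> length w"
    and "finite Q" "Q \<subseteq> lists {1..k}" "\<And>q. q \<in> Q \<Longrightarrow> length q < i"
  shows "\<nu> (Q \<union> W) = \<nu> (Q \<union> ones i r)"
  using assms
proof (induction r arbitrary: Q W i)
  case 0
  then show ?case by (simp add: ones_def)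
next
  case (Suc r)
  then have "W \<noteq> {}" by auto
  then obtain w where w: "w \<in> W" "\<And>v. v \<in> W \<Longrightarrow> length w \<le> length v"
    using ex_min_if_finite[of "length ` W"] Suc.prems(1) by (metis (no_types, lifting) arg_min_if_finite(1) arg_min_least)
  have ww: "w \<in> lists {1..k}" "i \<le> length w" using w Suc.prems by auto
  have longer: "Suc (length w) \<le> length v" if "v \<in> W - {w}" for v
    using that w Suc.prems(3) by (metis DiffE inj_onD le_neq_implies_less Suc_leI singletonI)
  have "length q < Suc (length w)" if "q \<in> insert w Q" for q
    using that Suc.prems(8)[of q] ww(2) by (cases "q = w") auto
  with Suc.prems(6,7) ww
  have Qw: "finite (insert w Q)" "insert w Q \<subseteq> lists {1..k}" "\<And>q. q \<in> insert w Q \<Longrightarrow> length q < Suc (length w)"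
    by auto
  have "\<nu> (Q \<union> W) = \<nu> (insert w Q \<union> (W - {w}))" using w(1) by (intro arg_cong[of _ _ \<nu>]) auto
  also have "\<dots> = \<nu> (insert w Q \<union> ones (Suc (length w)) r)"
    using Suc.prems w(1) Qw longer by (intro Suc.IH) (auto intro: inj_on_subset)
  also have "\<dots> = \<nu> (insert w Q \<union> (@) (replicate (Suc (length w)) 1) ` ones 0 r)"
    by (simp only: ones_shift add_0_right)
  also have "\<dots> = \<nu> (insert w Q \<union> (@) (w @ [1]) ` ones 0 r)"
    using Qw ww k_pos ones_words by (intro tail_invariant) auto
  also have "\<dots> = \<nu> (Q \<union> (@) w ` ones 0 (Suc r))"
    by (simp add: ones_0_Suc image_image)
  also have "\<dots> = \<nu> (Q \<union> (@) (replicate i 1) ` ones 0 (Suc r))"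
    using Suc.prems(6-8) ww k_pos ones_words by (intro tail_invariant) (auto intro: less_le_trans)
  finally show ?case by (simp only: ones_shift add_0_right)
qed

section \<open>Chains of words\<close>

text \<open>By \<open>distinct_lengths\<close> the events along a chain are exchangeable; these
  numbers play the part of the moments of a mixing variable with values in
  \<open>[0,1]\<close>.\<close>

definition chain_prob :: "nat \<Rightarrow> real"
  where "chain_prob r = \<nu> (ones 0 r)"

lemma distinct_lengths:
  assumes "finite W" "W \<subseteq> lists {1..k}" "inj_on length W"
  shows "\<nu> W = chain_prob (card W)"
  using distinct_lengths_aux[OF assms refl, of 0 "{}"] by (simp add: chain_prob_def)

lemma chain_prob_nonneg: "0 \<le> chain_prob r"
  unfolding chain_prob_def by (rule prob_bounds[OF finite_ones ones_words])

lemma chain_prob_0: "chain_prob 0 = 1"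
  using law_words[of 0] by (auto simp: chain_prob_def ones_def law_def Pow_def)

text \<open>Restricted to a chain \<open>C\<close> of size \<open>r\<close>, the number of occurring
  \<open>z j\<close> minus \<open>\<epsilon> * N\<close> has nonnegative second moment. In the limit
  \<open>chain_prob (r + 2) \<ge> 2 * \<epsilon> * chain_prob (r + 1) - \<epsilon>\<^sup>2 *
  chain_prob r\<close>, and the induction hypothesis bounds the last term.\<close>

lemma chain_prob_Suc: "\<epsilon> * chain_prob r \<le> chain_prob (Suc r)"
proof (induction r)
  case 0
  have "chain_prob (Suc 0) = \<nu> {[]}" by (simp add: chain_prob_def ones_def lessThan_Suc)
  then show ?case using lower[of "[]"] by (simp add: chain_prob_0)
next
  case (Suc r)
  have "0 \<le> (real N)\<^sup>2 * (chain_prob (r + 2) - 2 * \<epsilon> * chain_prob (r + 1) + \<epsilon>\<^sup>2 * chain_prob r) + 1 * real N"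
    for N :: nat
  proof -
    define z where "z j = replicate (r + j) (1::nat)" for j
    define C where "C = ones 0 r"
    define G where "G p = (case p of None \<Rightarrow> C | Some j \<Rightarrow> insert (z j) C)" for p
    \<comment> \<open>The index \<open>None\<close> stands for the constant
      \<open>- (\<epsilon> * N)\<close> on the event of \<open>C\<close>, the indices
      \<open>Some j\<close> for the \<open>N\<close> further events.\<close>
    define c where "c p = (case p of None \<Rightarrow> - (\<epsilon> * real N) | Some (j::nat) \<Rightarrow> 1)" for p
    have z: "z j \<in> lists {1..k}" for j using k_pos by (auto simp: z_def)
    have C: "finite C" "C \<subseteq> lists {1..k}" "card C = r" "inj_on length C"
      using ones_words by (auto simp: C_def card_ones inj_on_length_ones)
    have zC: "length q < length (z j)" if "q \<in> C" for q j using that by (auto simp: C_def z_def ones_def)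
    have Cr: "\<nu> C = chain_prob r" by (simp add: chain_prob_def C_def)
    have single: "\<nu> (insert (z j) C) = chain_prob (r + 1)" for j
    proof -
      have "length (z j) \<noteq> length (z (Suc j))" by (simp add: z_def)
      from inj_on_length_insert_pair[OF C(4) zC zC this]
      have "inj_on length (insert (z j) C)" "z j \<notin> C" by (auto intro: inj_on_subset)
      then show ?thesis using C z by (subst distinct_lengths) auto
    qed
    have pair: "\<nu> (insert (z i) (insert (z j) C)) = chain_prob (r + 2)" if "i \<noteq> j" for i j
    proof -
      have "length (z i) \<noteq> length (z j)" using that by (simp add: z_def)
      from inj_on_length_insert_pair[OF C(4) zC zC this] show ?thesis using C z by (subst distinct_lengths) auto
    qed
    have "0 \<le> (\<Sum>i\<in>insert None (Some ` {..<N}). \<Sum>j\<in>insert None (Some ` {..<N}). c i * c j * \<nu> (G i \<union> G j))"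
      using C z by (intro positive_definite) (auto simp: G_def split: option.splits)
    also have "\<dots> = (\<epsilon> * real N)\<^sup>2 * chain_prob r - 2 * (\<epsilon> * real N) * (real N * chain_prob (r + 1))
        + (\<Sum>i<N. \<Sum>j<N. \<nu> (insert (z i) (insert (z j) C)))"
    proof -
      have *: "insert (z i) C \<union> insert (z j) C = insert (z i) (insert (z j) C)"
        "insert (z i) C \<union> C = insert (z i) C" "C \<union> insert (z i) C = insert (z i) C" for i j by auto
      show ?thesis
        by (simp add: c_def G_def sum.reindex sum.distrib sum_subtractf single power2_eq_square Cr *
            del: Un_insert_left Un_insert_right flip: sum_distrib_left)
    qed
    also have "\<dots> \<le> (\<epsilon> * real N)\<^sup>2 * chain_prob r - 2 * (\<epsilon> * real N) * (real N * chain_prob (r + 1))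
        + ((real N)\<^sup>2 * chain_prob (r + 2) + real N)"
      using C z pair by (intro add_left_mono double_sum_le) (simp_all add: chain_prob_nonneg prob_bounds)
    finally show ?thesis by (simp add: algebra_simps power2_eq_square)
  qed
  then have "0 \<le> chain_prob (r + 2) - 2 * \<epsilon> * chain_prob (r + 1) + \<epsilon>\<^sup>2 * chain_prob r"
    by (rule nonneg_of_linear_error)
  moreover have "\<epsilon> * (\<epsilon> * chain_prob r) \<le> \<epsilon> * chain_prob (Suc r)"
    using Suc eps_nonneg by (rule mult_left_mono)
  ultimately show ?case by (simp add: power2_eq_square)
qed

lemma chain_prob_ge: "\<epsilon> ^ r \<le> chain_prob r"
proof (induction r)
  case (Suc r)
  have "\<epsilon> ^ Suc r \<le> \<epsilon> * chain_prob r" using Suc eps_nonneg by (simp add: mult_left_mono)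
  then show ?case using chain_prob_Suc by (rule order_trans)
qed (simp add: chain_prob_0)

text \<open>Two embeddings in a row, both fixing \<open>Q\<close>: the first makes room after
  \<open>c\<close>, the second replaces each letter of \<open>u\<close> and \<open>v\<close> by a
  staircase block.\<close>

lemma stair_invariant:
  assumes Q: "finite Q" "Q \<subseteq> lists {1..k}" "\<And>q. q \<in> Q \<Longrightarrow> length q < length c"
    and words: "c \<in> lists {1..k}" "u \<in> lists {1..k}" "v \<in> lists {1..k}" "h \<in> lists {1..k}"
    and len: "length u = length v" and ij: "i < j" "j \<le> N"
  shows "\<nu> (insert (c @ h @ stair N i u v) (insert (c @ h @ stair N j u v) Q)) =
         \<nu> (insert (c @ u) (insert (c @ v) Q))"
proof -
  \<comment> \<open>After \<open>h\<close> comes the constant head of the first block, which no left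
    variable word can hold.\<close>
  define e where "e = h @ head_block i v"
  define us where "us = replicate (length (c @ e)) [None] @ stair_vars N i j u v"
  have e: "e \<in> lists {1..k}"
    using words by (auto simp: e_def head_block_def split: list.splits)
  have "insert_at (length c) e ` Q = id ` Q"
    by (intro image_cong refl) (simp add: insert_at_short Q(3))
  then have "\<nu> (insert (c @ u) (insert (c @ v) Q)) = \<nu> (insert (c @ e @ u) (insert (c @ e @ v) Q))"
    using insert_at_invariant[of "insert (c @ u) (insert (c @ v) Q)" e "length c"] Q words e
    by (simp add: insert_at_append)
  also have "\<dots> = \<nu> ((\<lambda>s. [] @ inst us s) ` insert (c @ e @ u) (insert (c @ e @ v) Q))"
  proof (rule embed[symmetric])
    show "set us \<subseteq> left_variable_words k"
      using stair_vars_left[OF len ij(1), of k N] words by (auto simp: us_def left_variable_words_def)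
    show "insert (c @ e @ u) (insert (c @ e @ v) Q) \<subseteq> words k (length us)"
      using words e Q stair_vars_left[OF len ij(1), of k N] len
      by (fastforce simp: words_def us_def)
  qed simp
  also have "(\<lambda>s. [] @ inst us s) ` insert (c @ e @ u) (insert (c @ e @ v) Q)
      = insert (c @ h @ stair N i u v) (insert (c @ h @ stair N j u v) Q)"
  proof -
    have "inst us (c @ e @ u) = c @ h @ head_block i v @ inst (stair_vars N i j u v) u"
      "inst us (c @ e @ v) = c @ h @ head_block i v @ inst (stair_vars N i j u v) v"
      using len by (auto simp: us_def inst_replicate_append e_def)
    moreover have "inst us ` Q = id ` Q"
      using Q(3) by (intro image_cong refl) (force simp: us_def inst_replicate_append)
    ultimately show ?thesis using inst_stair_vars[OF len, of i j N] ij by simp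
  qed
  finally show ?thesis by simp
qed

text \<open>Compare the average of the events at \<open>N\<close> words, any two of which form a pair of the type of
  \<open>c @ u\<close>, \<open>c @ v\<close>, with the average over a chain: the second moment of the difference is nonnegative.\<close>

lemma fork_ge_chain:
  assumes Q: "finite Q" "Q \<subseteq> lists {1..k}" "\<And>q. q \<in> Q \<Longrightarrow> length q < length c" "inj_on length Q"
    and words: "c \<in> lists {1..k}" "u \<in> lists {1..k}" "v \<in> lists {1..k}" and len: "length u = length v"
  shows "chain_prob (card Q + 2) \<le> \<nu> (insert (c @ u) (insert (c @ v) Q))"
proof -
  define L where "L = \<nu> (insert (c @ u) (insert (c @ v) Q))"
  define A where "A = chain_prob (card Q + 2)"
  have "0 \<le> (real N)\<^sup>2 * (L - A) + 2 * real N" for N :: nat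
  proof -
    define z where "z j = replicate (length c + j) (1::nat)" for j
    \<comment> \<open>The \<open>N\<close> leading ones make \<open>s i\<close> longer than every
      \<open>z j\<close> with \<open>j < N\<close>. Mixed pairs thus have distinct lengths and
      probability \<open>A\<close>, so the second moment is at most
      \<open>N\<^sup>2 * (L - A) + 2 * N\<close>.\<close>
    define s where "s j = c @ replicate N 1 @ stair N j u v" for j
    have z: "z j \<in> lists {1..k}" for j using k_pos by (auto simp: z_def)
    have lz: "length (z j) = length c + j" for j by (simp add: z_def)
    have s: "s j \<in> lists {1..k}" for j
      using k_pos words set_stair[of N j u v] by (auto simp: s_def)
    define G where "G = (\<lambda>(b, j). if b then insert (s j) Q else insert (z j) Q)"
    have dist: "\<nu> (insert x (insert y Q)) = A"
      if "x \<in> lists {1..k}" "y \<in> lists {1..k}" "length c \<le> length x" "length c \<le> length y" "length x \<noteq> length y" for x y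
    proof -
      have "length q < length x" "length q < length y" if "q \<in> Q" for q
        using Q(3)[OF that] \<open>length c \<le> length x\<close> \<open>length c \<le> length y\<close> by auto
      from inj_on_length_insert_pair[OF Q(4) this that(5)] show ?thesis using Q that by (subst distinct_lengths) (auto simp: A_def)
    qed
    have "0 \<le> (\<Sum>p\<in>UNIV \<times> {..<N}. \<Sum>p'\<in>UNIV \<times> {..<N}.
        (if fst p then 1 else - 1) * (if fst p' then 1 else - 1) * \<nu> (G p \<union> G p'))"
    proof (rule positive_definite)
      show "finite (G p)" "G p \<subseteq> lists {1..k}" for p using Q(1,2) z s by (cases p; simp add: G_def)+
    qed simp
    also have "\<dots> = (\<Sum>i<N. \<Sum>j<N. \<nu> (insert (s i) (insert (s j) Q)))
        + (\<Sum>i<N. \<Sum>j<N. \<nu> (insert (z i) (insert (z j) Q)))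
        - (\<Sum>i<N. \<Sum>j<N. \<nu> (insert (s i) (insert (z j) Q)))
        - (\<Sum>i<N. \<Sum>j<N. \<nu> (insert (z i) (insert (s j) Q)))"
    proof -
      have *: "insert x Q \<union> insert y Q = insert x (insert y Q)" for x y by auto
      show ?thesis
        by (simp add: sum.cartesian_product' UNIV_bool G_def sum.distrib sum_subtractf sum_negf *
            del: Un_insert_left Un_insert_right)
    qed
    also have "(\<Sum>i<N. \<Sum>j<N. \<nu> (insert (s i) (insert (z j) Q))) = (real N)\<^sup>2 * A"
    proof -
      have "\<nu> (insert (s i) (insert (z j) Q)) = A" if "j < N" for i j
        using that s z by (intro dist) (auto simp: s_def z_def)
      then show ?thesis by (simp add: power2_eq_square)
    qed
    also have "(\<Sum>i<N. \<Sum>j<N. \<nu> (insert (z i) (insert (s j) Q))) = (real N)\<^sup>2 * A"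
    proof -
      have "\<nu> (insert (z i) (insert (s j) Q)) = A" if "i < N" for i j
        using that s z by (intro dist) (auto simp: s_def z_def)
      then show ?thesis by (simp add: power2_eq_square)
    qed
    also have "(\<Sum>i<N. \<Sum>j<N. \<nu> (insert (s i) (insert (s j) Q))) \<le> (real N)\<^sup>2 * L + real N"
    proof (rule double_sum_le)
      have less: "\<nu> (insert (s i) (insert (s j) Q)) = L" if "i < j" "j < N" for i j
        unfolding s_def L_def using that k_pos by (intro stair_invariant Q words len) auto
      show "\<nu> (insert (s i) (insert (s j) Q)) \<le> L" if "i < N" "j < N" "i \<noteq> j" for i j
        using that less[of i j] less[of j i] by (cases i j rule: linorder_cases) (auto simp: insert_commute)
    qed (use Q s words in \<open>simp_all add: L_def prob_bounds\<close>)
    also have "(\<Sum>i<N. \<Sum>j<N. \<nu> (insert (z i) (insert (z j) Q))) \<le> (real N)\<^sup>2 * A + real N"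
    proof (rule double_sum_le)
      show "\<nu> (insert (z i) (insert (z j) Q)) \<le> A" if "i < N" "j < N" "i \<noteq> j" for i j
        using that dist[OF z z, of i j] by (simp add: lz)
    qed (use Q z in \<open>simp_all add: A_def chain_prob_nonneg prob_bounds\<close>)
    finally show ?thesis by (simp add: algebra_simps)
  qed
  then have "0 \<le> L - A" by (rule nonneg_of_linear_error)
  then show ?thesis by (simp add: L_def A_def)
qed

lemma free_pair_ge:
  assumes Q: "finite Q" "Q \<subseteq> lists {1..k}" "inj_on length Q"
    and xy: "x \<in> lists {1..k}" "y \<in> lists {1..k}" "x \<noteq> y"
    and short: "\<And>q. q \<in> Q \<Longrightarrow> length q < length (longest_common_prefix x y)"
  shows "\<epsilon> ^ (card Q + 2) \<le> \<nu> (insert x (insert y Q))"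
proof -
  define c where "c = longest_common_prefix x y"
  obtain u where u: "x = c @ u" using longest_common_prefix_prefix1 unfolding c_def by (rule prefixE)
  obtain v where v: "y = c @ v" using longest_common_prefix_prefix2 unfolding c_def by (rule prefixE)
  have words: "c \<in> lists {1..k}" "u \<in> lists {1..k}" "v \<in> lists {1..k}"
    using xy(1,2) by (simp_all add: u v)
  have len: "length c \<le> length x" "length c \<le> length y"
    by (simp_all add: u v)
  have "chain_prob (card Q + 2) \<le> \<nu> (insert x (insert y Q))"
  proof (cases "length x = length y")
    case True
    then have "length u = length v" by (simp add: u v)
    then have "chain_prob (card Q + 2) \<le> \<nu> (insert (c @ u) (insert (c @ v) Q))"
      using Q short[folded c_def] words by (intro fork_ge_chain)
    then show ?thesis by (simp add: u v)
  next
    case False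
    have "length q < length x" "length q < length y" if "q \<in> Q" for q
      using short[OF that] len by (auto simp: c_def)
    from inj_on_length_insert_pair[OF Q(3) this False] show ?thesis using Q xy by (subst distinct_lengths) auto
  qed
  then show ?thesis using chain_prob_ge[of "card Q + 2"] by simp
qed

end

section \<open>Limit laws and compactness\<close>

lemma subst_var_words:
  assumes "set v \<subseteq> insert None (Some ` {1..k})" "a \<in> {1..k}"
  shows "subst_var v a \<in> lists {1..k}"
  using assms by (induction v) (auto simp: subst_var_Cons)

lemma inst_words:
  assumes "set vs \<subseteq> left_variable_words k" "s \<in> lists {1..k}"
  shows "inst vs s \<in> lists {1..k}"
  using assms
proof (induction vs s rule: list_induct2')
  case (4 v vs a s)
  have "subst_var v a \<in> lists {1..k}"
    using 4 by (intro subst_var_words) (auto simp: left_variable_words_def)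
  then show ?case using 4 by simp
qed simp_all

lemma length_concat_take_mono: "i \<le> j \<Longrightarrow> length (concat (take i vs)) \<le> length (concat (take j vs))"
  by (metis concat_append length_append le_add1 min.absorb1 append_take_drop_id take_take)

lemma length_inst_le: "length (inst vs s) \<le> length (concat vs)"
  by (induction vs s rule: list_induct2') auto

section \<open>The limit law along generic subtrees\<close>

text \<open>The extra leading letter 1 accounts for roots: a constant prefix \<open>h\<close> is not
  a left variable word, but \<open>None # map Some h\<close> is one and can be absorbed by the first
  generic word.\<close>

definition limit_law :: "nat option list filter \<Rightarrow> (nat list set \<Rightarrow> real) \<Rightarrow> nat list set \<Rightarrow> real"
  where "limit_law l \<nu> G =
    Lim (generic l (Suc (Max (insert 0 (length ` G))))) (\<lambda>vs. \<nu> (inst vs ` (#) 1 ` G))"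

context
  fixes k :: nat and l :: "nat option list filter" and \<nu> :: "nat list set \<Rightarrow> real"
  assumes k_pos: "1 \<le> k" and l: "ultrafilter l" "l \<le> principal (left_variable_words k)"
    and absorb: "\<And>e. e \<in> letters k \<Longrightarrow> l \<odot> filtermap (subst_letter e) l = l"
    and law: "\<And>m. law (words k m) \<nu>"
begin

lemma eventually_generic_left:
  "\<forall>\<^sub>F vs in generic l m. length vs = m \<and> set vs \<subseteq> left_variable_words k"
  using l(2) by (intro eventually_generic) (simp add: le_principal)

lemma eventually_law:
  "\<forall>\<^sub>F vs in generic l (Suc m). law (words k m) (\<lambda>G. \<nu> (inst vs ` (#) 1 ` G))"
  using eventually_generic_left
proof eventually_elim
  case (elim vs)
  have "(\<lambda>s. inst vs (1 # s)) ` words k m \<subseteq> words k (length (concat vs))"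
  proof (rule image_subsetI)
    fix s assume "s \<in> words k m"
    then have "inst vs (1 # s) \<in> lists {1..k}" using elim k_pos by (intro inst_words) (auto simp: words_def)
    then show "inst vs (1 # s) \<in> words k (length (concat vs))"
      using length_inst_le[of vs "1 # s"] by (simp add: words_def)
  qed
  from law_image[OF law finite_words finite_words this] show ?case by (simp add: image_image)
qed

lemma limit_law_tendsto:
  assumes "G \<subseteq> words k m"
  shows "((\<lambda>vs. \<nu> (inst vs ` (#) 1 ` G)) \<longlongrightarrow> limit_law l \<nu> G) (generic l (Suc m))"
proof -
  define i where "i = Max (insert 0 (length ` G))"
  have fin: "finite G" using assms finite_words finite_subset by blast
  have Gi: "G \<subseteq> words k i" using assms fin by (auto simp: words_def i_def)
  have "i \<le> m" using assms fin by (auto simp: words_def i_def)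
  then obtain j where j: "Suc m = Suc i + j" by (metis add_Suc le_iff_add)
  have "((\<lambda>vs. \<nu> (inst vs ` (#) 1 ` G)) \<longlongrightarrow> limit_law l \<nu> G) (generic l (Suc i))"
    unfolding limit_law_def i_def[symmetric]
    using law_Lim_tendsto[OF ultrafilter_generic[OF l(1)] eventually_law finite_words Gi] .
  then have "((\<lambda>vs. \<nu> (inst (take (Suc i) vs) ` (#) 1 ` G)) \<longlongrightarrow> limit_law l \<nu> G) (generic l (Suc m))"
    unfolding j by (subst (asm) filtermap_take_generic[OF l(1), of "Suc i" j, symmetric]) (simp add: filterlim_filtermap)
  moreover have "inst (take (Suc i) vs) ` (#) 1 ` G = inst vs ` (#) 1 ` G" for vs
    using Gi unfolding image_image by (intro image_cong refl inst_take) (auto simp: words_def)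
  ultimately show ?thesis by simp
qed

lemma limit_law_words: "law (words k m) (limit_law l \<nu>)"
proof -
  have "limit_law l \<nu> G = Lim (generic l (Suc m)) (\<lambda>vs. \<nu> (inst vs ` (#) 1 ` G))" if "G \<subseteq> words k m" for G
    using tendsto_Lim[OF ultrafilter_not_bot limit_law_tendsto[OF that]] ultrafilter_generic[OF l(1)] by metis
  then show ?thesis
    using law_Lim_law[OF ultrafilter_generic[OF l(1)] eventually_law finite_words, of m]
    by (simp cong: law_cong)
qed

text \<open>Merging a generic sequence along \<open>us'\<close> gives a generic sequence, so both
  sides are limits of the same function of the longer sequence.\<close>

lemma limit_law_embed:
  assumes "h \<in> lists {1..k}" "set us \<subseteq> left_variable_words k" "G \<subseteq> words k (length us)"
  shows "limit_law l \<nu> ((\<lambda>s. h @ inst us s) ` G) = limit_law l \<nu> G"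
proof -
  define us' where "us' = (None # map Some h) # us"
  have us': "set us' \<subseteq> left_variable_words k"
    using assms by (auto simp: us'_def left_variable_words_def)
  define m where "m = length h + length (concat us)"
  have m: "length (concat us') = Suc m" by (simp add: us'_def m_def)
  have inst': "inst us' (1 # s) = 1 # h @ inst us s" for s by (simp add: us'_def)
  have img: "(\<lambda>s. h @ inst us s) ` G \<subseteq> words k m"
  proof (rule image_subsetI)
    fix s assume "s \<in> G"
    then have "inst us s \<in> lists {1..k}" using assms(3) by (intro inst_words[OF assms(2)]) (auto simp: words_def)
    then show "h @ inst us s \<in> words k m"
      using assms(1) length_inst_le[of us s] by (simp add: words_def m_def)
  qed
  have "((\<lambda>vs. \<nu> (inst vs ` (#) 1 ` G)) \<longlongrightarrow> limit_law l \<nu> G) (generic l (length us'))"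
    using limit_law_tendsto[OF assms(3)] by (simp add: us'_def)
  then have "((\<lambda>vs. \<nu> (inst (compose vs us') ` (#) 1 ` G)) \<longlongrightarrow> limit_law l \<nu> G) (generic l (Suc m))"
    unfolding m[symmetric]
    by (subst (asm) filtermap_compose[OF absorb us', symmetric]) (simp_all add: filterlim_filtermap)
  moreover have "\<forall>\<^sub>F vs in generic l (Suc m).
      \<nu> (inst (compose vs us') ` (#) 1 ` G) = \<nu> (inst vs ` (#) 1 ` (\<lambda>s. h @ inst us s) ` G)"
    using eventually_generic_left
  proof eventually_elim
    case (elim vs)
    have "inst (compose vs us') (1 # s) = inst vs (1 # h @ inst us s)" if "s \<in> G" for s
      using that assms(3) elim m unfolding inst'[symmetric]
      by (intro inst_compose) (auto simp: words_def us'_def)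
    then show ?case unfolding image_image by (intro arg_cong[of _ _ \<nu>] image_cong refl)
  qed
  ultimately have "((\<lambda>vs. \<nu> (inst vs ` (#) 1 ` (\<lambda>s. h @ inst us s) ` G)) \<longlongrightarrow> limit_law l \<nu> G) (generic l (Suc m))"
    by (rule Lim_transform_eventually)
  with limit_law_tendsto[OF img] show ?thesis
    using tendsto_unique ultrafilter_not_bot[OF ultrafilter_generic[OF l(1)]] by blast
qed

lemma word_law_limit_law:
  assumes "0 \<le> \<epsilon>" "\<And>w. w \<in> lists {1..k} \<Longrightarrow> \<epsilon> \<le> \<nu> {w}"
  shows "word_law k (limit_law l \<nu>) \<epsilon>"
proof
  fix w assume w: "w \<in> lists {1..k}"
  then have "{w} \<subseteq> words k (length w)" by (simp add: words_def)
  from limit_law_tendsto[OF this] show "\<epsilon> \<le> limit_law l \<nu> {w}"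
  proof (rule tendsto_lowerbound)
    show "\<forall>\<^sub>F vs in generic l (Suc (length w)). \<epsilon> \<le> \<nu> (inst vs ` (#) 1 ` {w})"
      using eventually_generic_left
      by eventually_elim (use assms(2) inst_words w k_pos in \<open>simp del: inst_simps\<close>)
  qed (use l(1) ultrafilter_generic ultrafilter_not_bot in blast)
qed (use k_pos assms limit_law_words limit_law_embed in auto)

end

section \<open>Free sets under embeddings\<close>

text \<open>A weakening of membership in \<open>Fr\<close> for at least two words. The nested
  conditions on meets are relaxed to distinct lengths below the meet of the last two words, which is
  what the estimates use.\<close>

definition free_set :: "nat list set \<Rightarrow> bool"
  where "free_set F \<longleftrightarrow> (\<exists>Q x y. F = insert x (insert y Q) \<and> finite Q \<and> inj_on length Q \<and> x \<noteq> y \<and>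
           (\<forall>q\<in>Q. length q < length (longest_common_prefix x y)))"

lemma length_longest_common_prefix_le:
  "length (longest_common_prefix x y) \<le> length x" "length (longest_common_prefix x y) \<le> length y"
  by (simp_all add: prefix_length_le longest_common_prefix_prefix1 longest_common_prefix_prefix2)

lemma card_free_set:
  assumes "finite Q" "x \<noteq> y" "\<forall>q\<in>Q. length q < length (longest_common_prefix x y)"
  shows "card (insert x (insert y Q)) = card Q + 2"
proof -
  have "x \<notin> Q" "y \<notin> Q" using assms(3) length_longest_common_prefix_le[of x y] by (auto simp: not_less[symmetric])
  then show ?thesis using assms by simp
qed

lemma (in word_law) free_set_ge:
  assumes "free_set F" "F \<subseteq> lists {1..k}"
  shows "\<epsilon> ^ card F \<le> \<nu> F"
proof -
  obtain Q x y where F: "F = insert x (insert y Q)" "finite Q" "inj_on length Q" "x \<noteq> y"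
    "\<forall>q\<in>Q. length q < length (longest_common_prefix x y)"
    using assms(1) by (auto simp: free_set_def)
  then show ?thesis
    using assms(2) free_pair_ge[of Q x y] by (simp add: card_free_set del: power_Suc)
qed

lemma Fr_free_set:
  assumes "F \<in> Fr k (Suc (Suc n))"
  shows "free_set F \<and> card F = Suc (Suc n)"
  using assms
proof (induction n arbitrary: F)
  case 0
  then obtain x y where "F = {x, y}" "x \<noteq> y" by (auto simp: card_2_iff)
  then have "F = insert x (insert y {}) \<and> finite {} \<and> inj_on length ({} :: nat list set) \<and> x \<noteq> y \<and>
      (\<forall>q\<in>{}. length q < length (longest_common_prefix x y))" by simp
  then show ?case unfolding free_set_def using \<open>F = {x, y}\<close> \<open>x \<noteq> y\<close> by (metis card_2_iff numeral_2_eq_2)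
next
  case (Suc n)
  then obtain w G where F: "F = insert w G" and G: "G \<in> Fr k (Suc (Suc n))"
    and w: "length w < length (Longest_common_prefix G)" by auto
  from Suc.IH[OF G] obtain Q x y where Q: "G = insert x (insert y Q)" "finite Q" "inj_on length Q" "x \<noteq> y"
    "\<forall>q\<in>Q. length q < length (longest_common_prefix x y)" and card: "card G = Suc (Suc n)"
    by (auto simp: free_set_def)
  have wG: "length w < length g" if "g \<in> G" for g
    using w Longest_common_prefix_prefix[OF that] prefix_length_le by fastforce
  have "prefix (Longest_common_prefix G) x" "prefix (Longest_common_prefix G) y"
    using Q(1) by (auto intro: Longest_common_prefix_prefix)
  then have "prefix (Longest_common_prefix G) (longest_common_prefix x y)"
    by (rule longest_common_prefix_max_prefix)
  then have wxy: "length w < length (longest_common_prefix x y)" using w prefix_length_le by fastforce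
  have "w \<notin> G" using wG by blast
  then have "card F = Suc (Suc (Suc n))" using F card Q(1,2) by simp
  moreover have "inj_on length (insert w Q)"
    using Q(1,3) wG by (fastforce simp: inj_on_def)
  then have "F = insert x (insert y (insert w Q)) \<and> finite (insert w Q) \<and> inj_on length (insert w Q) \<and> x \<noteq> y \<and>
      (\<forall>q\<in>insert w Q. length q < length (longest_common_prefix x y))"
    using F Q wxy by (simp add: insert_commute)
  then have "free_set F" unfolding free_set_def by (intro exI)
  ultimately show ?case by simp
qed

lemma Fr_nonempty: "F \<in> Fr k n \<Longrightarrow> F \<noteq> {}"
  by (induction k n rule: Fr.induct) auto

lemma longest_common_prefix_append:
  "longest_common_prefix (u @ x) (u @ y) = u @ longest_common_prefix x y"
  by (induction u) simp_all

lemma subst_var_left: "v \<in> left_variable_words k \<Longrightarrow> \<exists>t. subst_var v a = a # t"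
  by (cases v) (auto simp: left_variable_words_def subst_var_Cons)

text \<open>Instances of a left variable word at different letters differ at their first letter, so
  no common prefix is gained beyond the branching point.\<close>

lemma longest_common_prefix_inst:
  assumes "set vs \<subseteq> left_variable_words k" "length x \<le> length vs" "length y \<le> length vs"
  shows "longest_common_prefix (inst vs x) (inst vs y) = inst vs (longest_common_prefix x y)"
  using assms
proof (induction vs arbitrary: x y)
  case (Cons v vs)
  show ?case
  proof (cases "x = [] \<or> y = []")
    case False
    then obtain a x' b y' where xy: "x = a # x'" "y = b # y'" by (metis neq_Nil_conv)
    show ?thesis
    proof (cases "a = b")
      case True
      then show ?thesis using Cons xy by (simp add: longest_common_prefix_append)
    next
      case False
      then show ?thesis
        using Cons.prems xy subst_var_left[of v k a] subst_var_left[of v k b] by auto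
    qed
  qed (cases "inst (v # vs) x"; auto)
qed simp

lemma inst_inject:
  assumes "set vs \<subseteq> left_variable_words k" "length x \<le> length vs" "length y \<le> length vs"
    and "inst vs x = inst vs y"
  shows "x = y"
  using assms
proof (induction vs arbitrary: x y)
  case (Cons v vs)
  have *: "inst (v # vs) (a # s) \<noteq> []" for a s
    using Cons.prems subst_var_left[of v k a] by auto
  show ?case
  proof (cases x; cases y)
    fix a x' b y' assume xy: "x = a # x'" "y = b # y'"
    obtain t where t: "subst_var v a = a # t" using Cons.prems subst_var_left[of v k a] by auto
    obtain t' where t': "subst_var v b = b # t'" using Cons.prems subst_var_left[of v k b] by auto
    have "a = b" using Cons.prems(4) by (simp add: xy t t')
    then show ?thesis using xy Cons by simp
  qed (use Cons.prems *[of "hd x" "tl x"] *[of "hd y" "tl y"] in auto)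
qed simp

text \<open>Freeness is pulled back from a tree to its coordinates: length in the tree depends only
  on the level, monotonically, and meets correspond.\<close>

lemma inst_free_set:
  fixes w :: "nat list"
  defines "\<Phi> \<equiv> \<lambda>vs s. w @ inst vs s"
  assumes vs: "set vs \<subseteq> left_variable_words k" and F: "F \<subseteq> words k (length vs)" "free_set (\<Phi> vs ` F)"
  shows "free_set F" "card F = card (\<Phi> vs ` F)"
proof -
  have len: "length s \<le> length vs" if "s \<in> F" for s using that F(1) by (auto simp: words_def)
  have inj: "inj_on (\<Phi> vs) F" using inst_inject[OF vs] len by (auto simp: inj_on_def \<Phi>_def)
  then show "card F = card (\<Phi> vs ` F)" by (simp add: card_image)
  obtain Q x' y' where Q: "\<Phi> vs ` F = insert x' (insert y' Q)" "finite Q" "inj_on length Q" "x' \<noteq> y'"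
    "\<forall>q\<in>Q. length q < length (longest_common_prefix x' y')"
    using F(2) by (auto simp: free_set_def)
  obtain x where x: "x \<in> F" "\<Phi> vs x = x'" using Q(1) by (metis imageE insertI1)
  obtain y where y: "y \<in> F" "\<Phi> vs y = y'" using Q(1) by (metis imageE insertI1 insertI2)
  let ?R = "{s \<in> F. \<Phi> vs s \<in> Q}"
  have "F = insert x (insert y ?R)"
  proof (intro equalityI subsetI)
    fix s assume s: "s \<in> F"
    then have "\<Phi> vs s \<in> insert x' (insert y' Q)" unfolding Q(1)[symmetric] by (rule imageI)
    then consider "\<Phi> vs s = \<Phi> vs x" | "\<Phi> vs s = \<Phi> vs y" | "\<Phi> vs s \<in> Q" using x(2) y(2) by (metis insertE)
    then show "s \<in> insert x (insert y ?R)"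
      using s inj_onD[OF inj _ s x(1)] inj_onD[OF inj _ s y(1)] by cases simp_all
  qed (use x y in auto)
  moreover have "finite ?R" using finite_subset[OF F(1) finite_words] by simp
  moreover have "inj_on length ?R"
  proof (rule inj_onI)
    fix s t assume s: "s \<in> ?R" "t \<in> ?R" "length s = length t"
    then have "length (\<Phi> vs s) = length (\<Phi> vs t)" using len by (simp add: \<Phi>_def length_inst)
    then have "\<Phi> vs s = \<Phi> vs t" using Q(3) s by (auto dest: inj_onD)
    then show "s = t" using inj s by (auto dest: inj_onD)
  qed
  moreover have "x \<noteq> y" using Q(4) x y by auto
  moreover have "length q < length (longest_common_prefix x y)" if "q \<in> ?R" for q
  proof -
    have "length (\<Phi> vs q) < length (longest_common_prefix x' y')" using that Q(5) by auto
    also have "longest_common_prefix x' y' = \<Phi> vs (longest_common_prefix x y)"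
      using longest_common_prefix_inst[OF vs] x y len by (auto simp: \<Phi>_def longest_common_prefix_append)
    finally have "length (inst vs q) < length (inst vs (longest_common_prefix x y))" by (simp add: \<Phi>_def)
    moreover have "length (longest_common_prefix x y) \<le> length vs"
      using length_longest_common_prefix_le(1)[of x y] len[OF x(1)] by simp
    moreover have "length q \<le> length vs" using that len by simp
    ultimately show ?thesis
      using length_concat_take_mono[of "length (longest_common_prefix x y)" "length q" vs]
      by (simp add: length_inst) (metis not_le_imp_less)
  qed
  ultimately show "free_set F" unfolding free_set_def by blast
qed

text \<open>Each bound is strict for the limit law and thus holds for generic sequences; the
  finitely many sets \<open>F\<close> share one such sequence.\<close>

lemma good_embedding:
  assumes "1 \<le> k" "\<And>m. law (words k m) \<nu>" "\<And>w. w \<in> lists {1..k} \<Longrightarrow> \<epsilon> \<le> \<nu> {w}" "0 \<le> \<theta>" "\<theta> < \<epsilon>"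
  shows "\<exists>h\<in>lists {1..k}. \<exists>vs. length vs = m \<and> set vs \<subseteq> left_variable_words k \<and>
    (\<forall>F. F \<subseteq> words k m \<longrightarrow> free_set F \<longrightarrow> \<theta> ^ card F < \<nu> ((\<lambda>s. h @ inst vs s) ` F))"
proof -
  obtain l where l: "ultrafilter l" "l \<le> principal (left_variable_words k)"
    "\<And>e. e \<in> letters k \<Longrightarrow> l \<odot> filtermap (subst_letter e) l = l"
    using left_variable_ultrafilter by blast
  interpret word_law k "limit_law l \<nu>" \<epsilon>
    using assms by (intro word_law_limit_law l) auto
  have "\<forall>\<^sub>F vs in generic l (Suc m). free_set F \<longrightarrow> \<theta> ^ card F < \<nu> (inst vs ` (#) 1 ` F)"
    if F: "F \<in> Pow (words k m)" for F
  proof (cases "free_set F")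
    case True
    then have "card F \<noteq> 0" unfolding free_set_def by (auto simp: card_gt_0_iff)
    then have "\<theta> ^ card F < \<epsilon> ^ card F" using assms(4,5) by (intro power_strict_mono) auto
    also have "\<dots> \<le> limit_law l \<nu> F" using F True by (intro free_set_ge) (auto simp: words_def)
    finally have "\<forall>\<^sub>F vs in generic l (Suc m). \<theta> ^ card F < \<nu> (inst vs ` (#) 1 ` F)"
      using F assms by (intro order_tendstoD(1)[OF limit_law_tendsto[OF _ l]]) auto
    then show ?thesis by eventually_elim simp
  qed simp
  then have "\<forall>\<^sub>F vs in generic l (Suc m). \<forall>F\<in>Pow (words k m). free_set F \<longrightarrow> \<theta> ^ card F < \<nu> (inst vs ` (#) 1 ` F)"
    by (intro eventually_ball_finite) auto
  moreover have "\<forall>\<^sub>F vs in generic l (Suc m). length vs = Suc m \<and> set vs \<subseteq> left_variable_words k"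
    using l(2) by (intro eventually_generic) (simp add: le_principal)
  ultimately have "\<forall>\<^sub>F vs in generic l (Suc m). length vs = Suc m \<and> set vs \<subseteq> left_variable_words k \<and>
      (\<forall>F\<in>Pow (words k m). free_set F \<longrightarrow> \<theta> ^ card F < \<nu> (inst vs ` (#) 1 ` F))"
    by eventually_elim blast
  then obtain vs where vs: "length vs = Suc m" "set vs \<subseteq> left_variable_words k"
      "\<forall>F\<in>Pow (words k m). free_set F \<longrightarrow> \<theta> ^ card F < \<nu> (inst vs ` (#) 1 ` F)"
    using eventually_happens'[OF ultrafilter_not_bot[OF ultrafilter_generic[OF l(1)]]] by blast
  \<comment> \<open>The first word, evaluated at the letter 1 built into \<open>limit_law\<close>,
    becomes the root.\<close>
  obtain v vs' where v: "vs = v # vs'" using vs(1) by (cases vs) auto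
  have "subst_var v 1 \<in> lists {1..k}"
    using inst_words[of "[v]" k "[1]"] vs(2) v assms(1) by simp
  moreover have "length vs' = m" "set vs' \<subseteq> left_variable_words k" using vs v by auto
  moreover have "\<theta> ^ card F < \<nu> ((\<lambda>s. subst_var v 1 @ inst vs' s) ` F)" if "F \<subseteq> words k m" "free_set F" for F
    using vs(3) that by (simp add: v image_image)
  ultimately show ?thesis by blast
qed

lemma cs_span_eq_image:
  "cs_span k w ws = (\<lambda>s. w @ inst ws s) ` words k (length ws)"
proof (intro equalityI subsetI)
  fix u assume "u \<in> cs_span k w ws"
  then consider "u = w" | n as where "u = w @ concat (map2 subst_var (take (Suc n) ws) as)"
    "n < length ws" "length as = Suc n" "set as \<subseteq> {1..k}" by (auto simp: cs_span_def)
  then show "u \<in> (\<lambda>s. w @ inst ws s) ` words k (length ws)"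
  proof cases
    case 1
    then show ?thesis by (intro image_eqI[of _ _ "[]"]) (auto simp: words_def)
  next
    case (2 n as)
    then show ?thesis using inst_take[of as "Suc n" ws]
      by (intro image_eqI[of _ _ as]) (auto simp: words_def inst_def)
  qed
next
  fix u assume "u \<in> (\<lambda>s. w @ inst ws s) ` words k (length ws)"
  then obtain s where s: "s \<in> lists {1..k}" "length s \<le> length ws" "u = w @ inst ws s" by (auto simp: words_def)
  show "u \<in> cs_span k w ws"
  proof (cases s)
    case Nil
    then show ?thesis using s by (simp add: cs_span_def)
  next
    case (Cons a s')
    then have "u = w @ concat (map2 subst_var (take (Suc (length s')) ws) s) \<and> length s' < length ws \<and>
       length s = Suc (length s') \<and> set s \<subseteq> {1..k}"
      using s inst_take[of s "Suc (length s')" ws] by (auto simp: inst_def)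
    then show ?thesis unfolding cs_span_def by blast
  qed
qed

lemma compose_left:
  assumes "set vs \<subseteq> left_variable_words k" "set us \<subseteq> left_variable_words k" "length (concat us) \<le> length vs"
  shows "set (compose vs us) \<subseteq> left_variable_words k \<and> length (compose vs us) = length us"
  using assms
proof (induction us arbitrary: vs)
  case (Cons u us)
  obtain u' where u: "u = None # u'" "set u' \<subseteq> letters k"
    using Cons.prems by (cases u) (auto simp: left_variable_words_def letters_def)
  obtain v vs' where v: "vs = v # vs'" "v \<in> left_variable_words k" "set vs' \<subseteq> left_variable_words k"
    using Cons.prems u by (cases vs) auto
  have "set (inst_var (take n vs') u') \<subseteq> letters k" for n
  proof -
    have "set (inst_var ws t) \<subseteq> letters k" if "set ws \<subseteq> left_variable_words k" "set t \<subseteq> letters k" for ws t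
      using that
      by (induction ws t rule: list_induct2')
        (auto simp: subst_letter_def left_variable_words_def letters_def split: option.splits)
    then show ?thesis using v u set_take_subset by (meson order_trans)
  qed
  then have "inst_var (take (length u) vs) u \<in> left_variable_words k"
    using v by (auto simp: u left_variable_words_def letters_def)
  moreover have "set (drop (length u) vs) \<subseteq> left_variable_words k"
    using Cons.prems(1) set_drop_subset by (metis order_trans)
  ultimately show ?case using Cons by auto
qed simp

section \<open>Compactness and independence of the type of points\<close>

text \<open>The type argument names the space of points, so that one predicate can be compared at
  two types.\<close>

definition Cor_property :: "'a itself \<Rightarrow> nat \<Rightarrow> nat \<Rightarrow> nat \<Rightarrow> real \<Rightarrow> real \<Rightarrow> nat \<Rightarrow> bool" where
  "Cor_property _ n k m \<theta> \<epsilon> N \<longleftrightarrow>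
    (\<forall>d W. N \<le> d \<longrightarrow> cs_tree k d W \<longrightarrow>
      (\<forall>(M :: 'a measure) A. prob_space M \<longrightarrow>
         (\<forall>w\<in>W. A w \<in> sets M \<and> \<epsilon> \<le> measure M (A w)) \<longrightarrow>
         (\<exists>U\<subseteq>W. cs_tree k m U \<and>
            (\<forall>F\<in>Fr k n. F \<subseteq> U \<longrightarrow> \<theta> ^ n \<le> measure M (\<Inter>w\<in>F. A w)))))"

lemma Cor_property_exists:
  assumes "1 \<le> k" "1 \<le> n" "1 \<le> m" "0 < \<theta>" "\<theta> < \<epsilon>"
  shows "\<exists>N. 0 < N \<and> Cor_property TYPE('a) n k m \<theta> \<epsilon> N"
proof (rule ccontr)
  assume "\<not> ?thesis"
  then have "\<forall>N. \<not> Cor_property TYPE('a) n k m \<theta> \<epsilon> (Suc N)" by blast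
  then have "\<forall>N. \<exists>w ws (M :: 'a measure) A. w \<in> lists {1..k} \<and> set ws \<subseteq> left_variable_words k \<and> N \<le> length ws \<and>
      prob_space M \<and> (\<forall>u\<in>cs_span k w ws. A u \<in> sets M \<and> \<epsilon> \<le> measure M (A u)) \<and>
      \<not> (\<exists>U\<subseteq>cs_span k w ws. cs_tree k m U \<and>
          (\<forall>F\<in>Fr k n. F \<subseteq> U \<longrightarrow> \<theta> ^ n \<le> measure M (\<Inter>w\<in>F. A w)))"
    unfolding Cor_property_def cs_tree_def by (metis Suc_leD)
  then obtain w ws and M :: "nat \<Rightarrow> 'a measure" and A where
    w: "\<And>N. w N \<in> lists {1..k}" and ws: "\<And>N. set (ws N) \<subseteq> left_variable_words k" "\<And>N. N \<le> length (ws N)"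
    and M: "\<And>N. prob_space (M N)"
    and A: "\<And>N u. u \<in> cs_span k (w N) (ws N) \<Longrightarrow> A N u \<in> sets (M N) \<and> \<epsilon> \<le> measure (M N) (A N u)"
    and bad: "\<And>N. \<not> (\<exists>U\<subseteq>cs_span k (w N) (ws N). cs_tree k m U \<and>
          (\<forall>F\<in>Fr k n. F \<subseteq> U \<longrightarrow> \<theta> ^ n \<le> measure (M N) (\<Inter>w\<in>F. A N w)))"
    by metis
  \<comment> \<open>Each counterexample is read in the coordinates of its own tree, so that all laws
    live on the same words.\<close>
  define f where "f N G = measure (M N) {x \<in> space (M N). \<forall>s\<in>G. x \<in> A N (w N @ inst (ws N) s)}" for N G
  have span: "w N @ inst (ws N) s \<in> cs_span k (w N) (ws N)" if "s \<in> words k (length (ws N))" for N s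
    using that by (auto simp: cs_span_eq_image)
  have law_f: "law (words k (length (ws N))) (f N)" for N
    unfolding f_def using A span by (intro law_measure M finite_words) auto
  \<comment> \<open>Below \<open>sequentially\<close>, so the dimensions tend to infinity and every
    finite set of words is eventually covered.\<close>
  obtain U where U: "U \<le> sequentially" "ultrafilter U"
    using ultrafilter_exists[of "sequentially"] by auto
  have evU: "\<forall>\<^sub>F N in U. i \<le> N" for i
    using U(1) eventually_ge_at_top[of i] by (rule filter_leD)
  have ev_words: "\<forall>\<^sub>F N in U. words k i \<subseteq> words k (length (ws N))" for i
    using evU[of i]
  proof eventually_elim
    case (elim N)
    then show ?case using ws(2)[of N] by (auto simp: words_def)
  qed
  have ev_law: "\<forall>\<^sub>F N in U. law (words k i) (f N)" for i
    using ev_words[of i] by eventually_elim (rule law_subset[OF law_f finite_words])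
  define \<nu> where "\<nu> G = Lim U (\<lambda>N. f N G)" for G
  have law: "law (words k i) \<nu>" for i
    unfolding \<nu>_def using law_Lim_law[OF U(2) ev_law finite_words] .
  have tends: "((\<lambda>N. f N G) \<longlongrightarrow> \<nu> G) U" if "G \<subseteq> words k i" for G i
    unfolding \<nu>_def using law_Lim_tendsto[OF U(2) ev_law finite_words that] .
  have lower: "\<epsilon> \<le> \<nu> {u}" if u: "u \<in> lists {1..k}" for u
  proof (rule tendsto_lowerbound)
    have "{u} \<subseteq> words k (length u)" using u by (auto simp: words_def)
    then show "((\<lambda>N. f N {u}) \<longlongrightarrow> \<nu> {u}) U" by (rule tends)
    show "\<forall>\<^sub>F N in U. \<epsilon> \<le> f N {u}"
      using ev_words[of "length u"]
    proof eventually_elim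
      case (elim N)
      then have *: "A N (w N @ inst (ws N) u) \<in> sets (M N)" "\<epsilon> \<le> measure (M N) (A N (w N @ inst (ws N) u))"
        using A[OF span] u by (auto simp: words_def)
      then have "{x \<in> space (M N). x \<in> A N (w N @ inst (ws N) u)} = A N (w N @ inst (ws N) u)"
        using sets.sets_into_space by blast
      then show ?case using * by (simp add: f_def)
    qed
  qed (rule ultrafilter_not_bot[OF U(2)])
  obtain h vs where h: "h \<in> lists {1..k}" and vs: "length vs = m" "set vs \<subseteq> left_variable_words k"
    and good: "\<And>F. F \<subseteq> words k m \<Longrightarrow> free_set F \<Longrightarrow> \<theta> ^ card F < \<nu> ((\<lambda>s. h @ inst vs s) ` F)"
    using good_embedding[OF assms(1) law lower less_imp_le[OF assms(4)] assms(5), of m] by blast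
  define i where "i = length h + length (concat vs)"
  have img: "h @ inst vs s \<in> words k i" if "s \<in> words k m" for s
    using that h inst_words[OF vs(2)] length_inst_le[of vs s] by (auto simp: words_def i_def)
  have "\<forall>\<^sub>F N in U. free_set F \<longrightarrow> \<theta> ^ card F < f N ((\<lambda>s. h @ inst vs s) ` F)" if "F \<in> Pow (words k m)" for F
  proof (cases "free_set F")
    case True
    have "(\<lambda>s. h @ inst vs s) ` F \<subseteq> words k i" using that img by auto
    then have "\<forall>\<^sub>F N in U. \<theta> ^ card F < f N ((\<lambda>s. h @ inst vs s) ` F)"
      using good[of F] that True by (intro order_tendstoD(1)[OF tends]) auto
    then show ?thesis by eventually_elim simp
  qed simp
  then have "\<forall>\<^sub>F N in U. \<forall>F\<in>Pow (words k m). free_set F \<longrightarrow> \<theta> ^ card F < f N ((\<lambda>s. h @ inst vs s) ` F)"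
    by (intro eventually_ball_finite) auto
  then have "\<forall>\<^sub>F N in U. i \<le> N \<and> (\<forall>F\<in>Pow (words k m). free_set F \<longrightarrow> \<theta> ^ card F < f N ((\<lambda>s. h @ inst vs s) ` F))"
    using evU[of i] by eventually_elim blast
  then obtain N where N: "i \<le> N" "\<And>F. F \<subseteq> words k m \<Longrightarrow> free_set F \<Longrightarrow> \<theta> ^ card F < f N ((\<lambda>s. h @ inst vs s) ` F)"
    using eventually_happens'[OF ultrafilter_not_bot[OF U(2)]] by blast
  \<comment> \<open>The embedding given by \<open>h\<close> and \<open>vs\<close> is composed with
    the tree \<open>ws N\<close>: the first \<open>length h\<close> variable words are spent on the
    root, the rest are merged along \<open>vs\<close>.\<close>
  define r where "r = w N @ inst (take (length h) (ws N)) h"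
  define us where "us = compose (drop (length h) (ws N)) vs"
  have iN: "i \<le> length (ws N)" using N(1) ws(2)[of N] by simp
  have us: "set us \<subseteq> left_variable_words k" "length us = m"
    using compose_left[of "drop (length h) (ws N)" k vs] ws(1)[of N] vs iN
      set_drop_subset[of "length h" "ws N"] by (auto simp: us_def i_def)
  have r: "r \<in> lists {1..k}"
    using w ws(1)[of N] h inst_words[of "take (length h) (ws N)" k h] set_take_subset[of "length h" "ws N"]
    by (auto simp: r_def)
  have comp: "r @ inst us s = w N @ inst (ws N) (h @ inst vs s)" if "s \<in> words k m" for s
    using that iN vs unfolding r_def us_def
    by (subst inst_split, subst inst_compose) (auto simp: words_def i_def)
  have span_us: "cs_span k r us = (\<lambda>s. r @ inst us s) ` words k m"
    by (simp add: cs_span_eq_image us)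
  have sub: "cs_span k r us \<subseteq> cs_span k (w N) (ws N)"
  proof
    fix u assume "u \<in> cs_span k r us"
    then obtain s where s: "s \<in> words k m" "u = r @ inst us s" by (auto simp: span_us)
    then have "h @ inst vs s \<in> words k (length (ws N))" using img iN by (force simp: words_def)
    then show "u \<in> cs_span k (w N) (ws N)" using s comp span by simp
  qed
  have "\<theta> ^ n \<le> measure (M N) (\<Inter>u\<in>F. A N u)" if F: "F \<in> Fr k n" "F \<subseteq> cs_span k r us" for F
  proof (cases "n = 1")
    \<comment> \<open>Singletons are not \<open>free_set\<close>; for them the hypothesis on single
      events suffices, as \<theta> is below \<epsilon>.\<close>
    case True
    then obtain u where "F = {u}" using F by auto
    then have "\<epsilon> \<le> measure (M N) (\<Inter>u\<in>F. A N u)" using A F(2) sub by auto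
    then show ?thesis using True assms(5) by simp
  next
    case False
    then obtain n' where n': "n = Suc (Suc n')" using assms(2) by (metis One_nat_def Suc_le_D not0_implies_Suc)
    have free: "free_set F" "card F = n" using Fr_free_set F(1) n' by auto
    define F' where "F' = {s \<in> words k m. r @ inst us s \<in> F}"
    have F': "F' \<subseteq> words k (length us)" "F = (\<lambda>s. r @ inst us s) ` F'"
      using F(2) by (auto simp: F'_def us span_us)
    have "free_set F'" "card F' = n" using inst_free_set[OF us(1) F'(1), of r] free F'(2) by auto
    then have "\<theta> ^ n < f N ((\<lambda>s. h @ inst vs s) ` F')" using N(2)[of F'] F'(1) us(2) by auto
    also have "{x \<in> space (M N). \<forall>s\<in>(\<lambda>s. h @ inst vs s) ` F'. x \<in> A N (w N @ inst (ws N) s)}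
        = {x \<in> space (M N). \<forall>u\<in>F. x \<in> A N u}"
      unfolding F'(2) using F'(1) us(2) comp by (auto simp: subset_iff)
    then have "f N ((\<lambda>s. h @ inst vs s) ` F') = measure (M N) {x \<in> space (M N). \<forall>u\<in>F. x \<in> A N u}"
      by (simp add: f_def)
    also have "{x \<in> space (M N). \<forall>u\<in>F. x \<in> A N u} = (\<Inter>u\<in>F. A N u)"
    proof -
      have "A N u \<subseteq> space (M N)" if "u \<in> F" for u
        using that A F(2) sub sets.sets_into_space by (meson subsetD)
      then show ?thesis using Fr_nonempty[OF F(1)] by blast
    qed
    finally show ?thesis by simp
  qed
  moreover have "cs_tree k m (cs_span k r us)"
    unfolding cs_tree_def using assms(3) r us by blast
  ultimately show False using bad[of N] sub by blast
qed

text \<open>Only the joint law of the finitely many events matters. The random set \<open>R\<close>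
  carries it to a probability space on \<open>Pow W\<close>, where the event of \<open>w\<close> is
  membership of \<open>w\<close>.\<close>

lemma Cor_property_transfer:
  assumes "Cor_property TYPE(nat list set) n k m \<theta> \<epsilon> N"
  shows "Cor_property TYPE('a) n k m \<theta> \<epsilon> N"
  unfolding Cor_property_def
proof (intro allI impI)
  fix d W and M :: "'a measure" and A
  assume W: "N \<le> d" "cs_tree k d W" and M: "prob_space M"
    and A: "\<forall>w\<in>W. A w \<in> sets M \<and> \<epsilon> \<le> measure M (A w)"
  interpret prob_space M by fact
  have fin: "finite W" using W(2) by (auto simp: cs_tree_def cs_span_eq_image)
  define R where "R x = {w \<in> W. x \<in> A w}" for x
  define M' where "M' = distr M (count_space (Pow W)) R"
  define A' where "A' w = {S \<in> Pow W. w \<in> S}" for w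
  have R: "R \<in> measurable M (count_space (Pow W))"
  proof (subst measurable_count_space_eq2)
    have "R -` {S} \<inter> space M = {x \<in> space M. {w \<in> W. x \<in> A w} = S}" for S
      by (simp add: vimage_def R_def Int_def conj_commute)
    then show "R \<in> space M \<rightarrow> Pow W \<and> (\<forall>S\<in>Pow W. R -` {S} \<inter> space M \<in> sets M)"
      using sets_trace[OF fin, of A M] A by (auto simp: R_def)
  qed (use fin in simp)
  have M': "prob_space M'" unfolding M'_def using R by (rule prob_space_distr)
  have meas: "measure M' (\<Inter>w\<in>F. A' w) = measure M (\<Inter>w\<in>F. A w)" if "F \<subseteq> W" "F \<noteq> {}" for F
  proof -
    have "(\<Inter>w\<in>F. A' w) \<in> sets (count_space (Pow W))" using that by (auto simp: A'_def)
    then have "measure M' (\<Inter>w\<in>F. A' w) = measure M (R -` (\<Inter>w\<in>F. A' w) \<inter> space M)"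
      unfolding M'_def using R by (simp add: measure_distr)
    also have "R -` (\<Inter>w\<in>F. A' w) \<inter> space M = (\<Inter>w\<in>F. A w)"
    proof -
      have "A w \<subseteq> space M" if "w \<in> W" for w using A that sets.sets_into_space by blast
      then show ?thesis using that by (fastforce simp: R_def A'_def)
    qed
    finally show ?thesis .
  qed
  have "\<forall>w\<in>W. A' w \<in> sets M' \<and> \<epsilon> \<le> measure M' (A' w)"
  proof
    fix w assume w: "w \<in> W"
    have "A' w \<in> sets M'" by (auto simp: M'_def A'_def)
    then show "A' w \<in> sets M' \<and> \<epsilon> \<le> measure M' (A' w)" using meas[of "{w}"] A w by simp
  qed
  from assms[unfolded Cor_property_def, THEN spec, THEN spec, THEN mp, OF W(1), THEN mp, OF W(2),
    THEN spec, THEN spec, THEN mp, OF M', THEN mp, OF this]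
  obtain U where U: "U \<subseteq> W" "cs_tree k m U"
    "\<And>F. F \<in> Fr k n \<Longrightarrow> F \<subseteq> U \<Longrightarrow> \<theta> ^ n \<le> measure M' (\<Inter>w\<in>F. A' w)"
    by blast
  have "\<theta> ^ n \<le> measure M (\<Inter>w\<in>F. A w)" if "F \<in> Fr k n" "F \<subseteq> U" for F
    using U(3)[OF that] meas[OF order_trans[OF that(2) U(1)] Fr_nonempty[OF that(1)]] by simp
  then show "\<exists>U\<subseteq>W. cs_tree k m U \<and> (\<forall>F\<in>Fr k n. F \<subseteq> U \<longrightarrow> \<theta> ^ n \<le> measure M (\<Inter>w\<in>F. A w))"
    using U by blast
qed

theorem theorem11p4:
  fixes k m n :: nat and \<theta> \<epsilon> :: real
  assumes "2 \<le> k" and "1 \<le> n" and "n \<le> m + 1" and "1 \<le> m"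
    and "0 < \<theta>" and "\<theta> < \<epsilon>" and "\<epsilon> \<le> 1"
  shows "0 < Cor n k m \<theta> \<epsilon> \<and>
    (\<forall>d W. Cor n k m \<theta> \<epsilon> \<le> d \<longrightarrow> cs_tree k d W \<longrightarrow>
      (\<forall>(M :: 'a measure) A. prob_space M \<longrightarrow>
         (\<forall>w\<in>W. A w \<in> sets M \<and> \<epsilon> \<le> measure M (A w)) \<longrightarrow>
         (\<exists>U\<subseteq>W. cs_tree k m U \<and>
            (\<forall>F\<in>Fr k n. F \<subseteq> U \<longrightarrow> \<theta> ^ n \<le> measure M (\<Inter>w\<in>F. A w)))))"
proof -
  have "Cor n k m \<theta> \<epsilon> = (LEAST N. 0 < N \<and> Cor_property TYPE(nat list set) n k m \<theta> \<epsilon> N)"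
    by (simp add: Cor_def Cor_property_def)
  then have "0 < Cor n k m \<theta> \<epsilon>" "Cor_property TYPE(nat list set) n k m \<theta> \<epsilon> (Cor n k m \<theta> \<epsilon>)"
    using LeastI_ex[OF Cor_property_exists[of k n m \<theta> \<epsilon>, where 'a = "nat list set"]] assms by simp_all
  from this(1) Cor_property_transfer[OF this(2), where 'a = 'a] show ?thesis
    unfolding Cor_property_def by (rule conjI)
qed

end
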